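(* For each fixed integer $q\ge2$, the following assertions hold, for sequences $p=p(n)\in(0,1]$. (i) For every $\eta>0$ there is $c_{q,\eta}>0$ such that, whenever $pn/\log n\to\infty$, asymptotically almost surely $G(n,p)$ contains a spanning triangle-free graph $H$ satisfying $$\delta(H)\ge(\alpha_q-\eta)pn\quad\text{and}\quad\operatorname{del}_q(H)\ge c_{q,\eta}\,pn^2.$$ (ii) For every fixed $0<\gamma<1-\alpha_q$, if $$\frac{pn}{\log n}\to\infty\quad\text{and}\quad np^2\to0,$$ then asymptotically almost surely $G(n,p)$ contains a spanning triangle-free graph $H$ satisfying $$\delta(H)\ge(\alpha_q+\gamma)pn\quad\text{and}\quad\operatorname{del}_q(H)=\left(\frac1{2q}+o(1)\right)pn^2.$$
   Context: All graphs are finite and simple. $G(n,p)$ is the binomial random graph on vertex set $[n]$, in which each pair of vertices is an edge independently with probability $p=p(n)\in(0,1]$. An event holds asymptotically almost surely if its probability tends to $1$ as $n\to\infty$. A subgraph $H\subseteq G(n,p)$ is spanning if its vertex set is $[n]$. $\delta$ denotes minimum degree. Logarithms are natural, and asymptotic notation refers to $n\to\infty$. For a graph $G$ and an integer $q\ge2$, $$\operatorname{del}_q(G)=\min_{\phi:V(G)\to[q]}\bigl|\{xy\in E(G):\phi(x)=\phi(y)\}\bigr|,$$ i.e. the minimum number of edges whose deletion makes $G$ $q$-partite. The constants $\alpha_q$ are: $\alpha_2=2/5$, $\alpha_3=10/29$, and $\alpha_q=1/3$ for every $q\ge4$. *)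

theory Defs
  imports "HOL-Probability.Probability" "HOL-Probability.Product_PMF"
begin

datatype 'a ugraph = UGraph (verts: "'a set") (edges: "'a set set")

definition vertex_pairs :: "'a set \<Rightarrow> 'a set set" where
  "vertex_pairs V = {e. e \<subseteq> V \<and> card e = 2}"

definition simple_graph :: "'a ugraph \<Rightarrow> bool" where
  "simple_graph G \<longleftrightarrow> finite (verts G) \<and> edges G \<subseteq> vertex_pairs (verts G)"

definition spanning_subgraph :: "'a ugraph \<Rightarrow> 'a ugraph \<Rightarrow> bool" where
  "spanning_subgraph H G \<longleftrightarrow> simple_graph H \<and> verts H = verts G \<and> edges H \<subseteq> edges G"

definition vertex_degree :: "'a ugraph \<Rightarrow> 'a \<Rightarrow> nat" where
  "vertex_degree G v = card {e \<in> edges G. v \<in> e}"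

text \<open>Only meaningful for a finite, nonempty vertex set.\<close>
definition min_degree :: "'a ugraph \<Rightarrow> nat" where
  "min_degree G = Min (vertex_degree G ` verts G)"

text \<open>In a simple graph edges have two elements, so the vertices below are automatically distinct.\<close>
definition triangle_free :: "'a ugraph \<Rightarrow> bool" where
  "triangle_free G \<longleftrightarrow>
     \<not> (\<exists>x y z. {x, y} \<in> edges G \<and> {y, z} \<in> edges G \<and> {x, z} \<in> edges G)"

definition mono_edges :: "'a ugraph \<Rightarrow> ('a \<Rightarrow> nat) \<Rightarrow> 'a set set" where
  "mono_edges G \<phi> = {e \<in> edges G. \<exists>x y. e = {x, y} \<and> \<phi> x = \<phi> y}"

text \<open>The colourings are taken extensional, so that \<open>Min\<close> ranges over a finite set.\<close>
definition del_partite :: "nat \<Rightarrow> 'a ugraph \<Rightarrow> nat" where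
  "del_partite q G = Min ((\<lambda>\<phi>. card (mono_edges G \<phi>)) ` (verts G \<rightarrow>\<^sub>E {1..q}))"

definition gnp :: "nat \<Rightarrow> real \<Rightarrow> nat ugraph pmf" where
  "gnp n p = map_pmf (\<lambda>f. UGraph {1..n} {e \<in> vertex_pairs {1..n}. f e})
               (Pi_pmf (vertex_pairs {1..n}) False (\<lambda>_. bernoulli_pmf p))"

definition asym_almost_surely :: "(nat \<Rightarrow> 'a pmf) \<Rightarrow> (nat \<Rightarrow> 'a \<Rightarrow> bool) \<Rightarrow> bool" where
  "asym_almost_surely M P \<longleftrightarrow> (\<lambda>n. measure_pmf.prob (M n) {x. P n x}) \<longlonglongrightarrow> 1"

definition alpha_const :: "nat \<Rightarrow> real" where
  "alpha_const q = (if q = 2 then 2/5 else if q = 3 then 10/29 else 1/3)"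

end

theory Submission
  imports Defs
begin

text \<open>For (i), take a fixed graph \<open>F\<close> on \<open>M\<close> vertices that is triangle-free, not \<open>q\<close>-colourable and of
  minimum degree at least \<open>(\<alpha>\<^sub>q - \<eta> / 2) M\<close>: the pentagon for \<open>q = 2\<close>, a weighted Groetzsch graph for
  \<open>q = 3\<close>, and Hajnal's graph built on a Kneser graph for \<open>q \<ge> 4\<close>. Let \<open>H\<close> be the intersection of
  the random graph with the balanced blow-up of \<open>F\<close> on \<open>[n]\<close>. A \<open>q\<close>-colouring of \<open>[n]\<close> induces one of \<open>F\<close> by
  majority, so it makes a positive proportion of the pairs of the blow-up monochromatic; Chernoff
  bounds and a union bound over vertices and over the \<open>q^n\<close> colourings conclude.

  For (ii), \<open>H\<close> is the random graph without the edges that lie in triangles. Conditioned on the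
  neighbourhood of a vertex, of size at most \<open>2pn\<close>, the number of edges inside it has mean
  \<open>O(pn \<cdot> np\<^sup>2) = o(pn)\<close>, so each vertex loses only \<open>o(pn)\<close> edges. The remaining assertions are
  concentration of degrees and of the number of monochromatic edges, and the count
  \<open>n\<^sup>2 / (2q) + O(n)\<close> of monochromatic pairs in a balanced colouring, which is the minimum.\<close>

section \<open>Kneser graphs\<close>

text \<open>The constants are ratios of weighted minimum degree to total weight. The pentagon
  attains 2/5 and the weighted Groetzsch graph 10/29; the ratio 1/3 is only approached, by Hajnal
  graphs over growing ground sets. There the Kneser graph supplies the chromatic number and two
  further layers supply the degrees. The chromatic number is Lovasz's theorem, usually drawn from
  Borsuk-Ulam; a parity count over flags of signed sets takes the place of topology.

  The union over vertices needs pn to beat multiples of log n; the union over colourings needs only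
  that pn is unbounded, since those events have exponents of order pn^2.

  In (ii), np^2 is the order of the number of triangles on a given edge, so all but a vanishing
  share of each degree survives and every ratio below 1 is reachable. The obstacle is that the
  neighbourhood searched for edges is itself random; the pairs at its centre are therefore revealed
  first. The error o(1) must be one sequence, which a diagonal choice extracts from the statements
  with fixed error.\<close>

lemma even_card_involution:
  assumes "finite A" "\<And>x. x \<in> A \<Longrightarrow> f x \<in> A" "\<And>x. x \<in> A \<Longrightarrow> f (f x) = x"
    "\<And>x. x \<in> A \<Longrightarrow> f x \<noteq> x"
  shows "even (card A)"
  using assms
proof (induction "card A" arbitrary: A rule: less_induct)
  case less
  show ?case
  proof (cases "A = {}")
    case False
    then obtain x where x: "x \<in> A" by blast
    let ?B = "A - {x, f x}"
    have fx: "f x \<in> A" "f x \<noteq> x" using less.prems x by auto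
    have c: "card A = card ?B + 2"
    proof -
      have "card {x, f x} = 2" using fx by auto
      moreover have "card A = card ?B + card {x, f x}"
        using less.prems(1) x fx card_Un_disjoint[of ?B "{x, f x}"]
        by (metis (no_types, lifting) Diff_disjoint Diff_partition bot.extremum card_Diff_subset
            finite.intros finite_Diff inf_commute insert_subset sup_commute)
      ultimately show ?thesis by simp
    qed
    have "even (card ?B)"
    proof (rule less.hyps)
      show "card ?B < card A" using c by simp
      show "finite ?B" using less.prems(1) by simp
      fix y assume y: "y \<in> ?B"
      then show "f (f y) = y" "f y \<noteq> y" using less.prems by auto
      show "f y \<in> ?B" using y less.prems x fx
        by (metis Diff_iff insert_iff singleton_iff)
    qed
    then show ?thesis using c by simp
  qed simp
qed

text \<open>A list in \<open>signed_perms n\<close> encodes a full flag of faces of the octahedral \<open>(n - 1)\<close>-sphere, that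
  is, a facet of its barycentric subdivision: the \<open>i\<close>-th face is the set of its first \<open>i\<close> entries.\<close>
definition signed_perms :: "nat \<Rightarrow> (nat \<times> bool) list set" where
  "signed_perms n = {xs. distinct (map fst xs) \<and> fst ` set xs = {..<n}}"

definition antipode :: "(nat \<times> bool) set \<Rightarrow> (nat \<times> bool) set" where
  "antipode X = map_prod id Not ` X"

lemma length_signed_perms: "xs \<in> signed_perms n \<Longrightarrow> length xs = n"
  unfolding signed_perms_def by (metis (mono_tags, lifting) card_lessThan distinct_card length_map list.set_map mem_Collect_eq)

lemma finite_signed_perms [simp]: "finite (signed_perms n)"
proof (rule finite_subset)
  show "signed_perms n \<subseteq> {xs. set xs \<subseteq> {..<n} \<times> UNIV \<and> length xs = n}"
    by (auto simp: length_signed_perms)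
      (force simp: signed_perms_def)
  show "finite {xs. set xs \<subseteq> {..<n} \<times> (UNIV :: bool set) \<and> length xs = n}"
    by (rule finite_lists_length_eq) auto
qed

lemma signed_perms_0: "signed_perms 0 = {[]}"
  by (auto simp: signed_perms_def)

text \<open>The value at \<open>j\<close> itself is free. A sequence that is true up to an inner
  position \<open>t\<close> and false afterwards is therefore counted twice, for
  \<open>j = t\<close> and \<open>j = t + 1\<close>; a constant sequence is counted once, at one
  end; any other sequence never.\<close>

lemma odd_card_switch_points:
  fixes u :: "nat \<Rightarrow> bool"
  assumes "N \<ge> 1"
  shows "odd (card {j\<in>{1..N}. \<forall>i\<in>{1..N}. (i < j \<longrightarrow> u i) \<and> (j < i \<longrightarrow> \<not> u i)}) \<longleftrightarrow>
    (\<forall>i\<in>{1..N}. u i) \<or> (\<forall>i\<in>{1..N}. \<not> u i)"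
  using assms
proof (induction N rule: nat_induct_at_least)
  case base
  have "{j\<in>{1..1::nat}. \<forall>i\<in>{1..1}. (i < j \<longrightarrow> u i) \<and> (j < i \<longrightarrow> \<not> u i)} = {1}" by auto
  then show ?case by simp
next
  case (Suc N)
  let ?P = "\<lambda>N. {j\<in>{1..N}. \<forall>i\<in>{1..N}. (i < j \<longrightarrow> u i) \<and> (j < i \<longrightarrow> \<not> u i)}"
  let ?all = "\<forall>i\<in>{1..N}. u i"
  have one: "\<exists>i. i \<in> {1..N}" using Suc.hyps by (intro exI[of _ 1]) simp
  show ?case
  proof (cases "u (Suc N)")
    case True
    have "?P (Suc N) = (if ?all then {Suc N} else {})"
      using True by (auto simp: le_Suc_eq)
    moreover have "\<not> (\<forall>i\<in>{1..Suc N}. \<not> u i)" using True by auto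
    moreover have "(\<forall>i\<in>{1..Suc N}. u i) \<longleftrightarrow> ?all" using True by (auto simp: le_Suc_eq)
    ultimately show ?thesis by simp
  next
    case False
    have eq: "?P (Suc N) = ?P N \<union> (if ?all then {Suc N} else {})"
      using False by (auto simp: le_Suc_eq)
    have "card (?P (Suc N)) = card (?P N) + (if ?all then 1 else 0)"
      unfolding eq by (subst card_Un_disjoint) auto
    then have "odd (card (?P (Suc N))) \<longleftrightarrow> (odd (card (?P N)) \<noteq> ?all)"
      by simp
    moreover have "\<not> (\<forall>i\<in>{1..Suc N}. u i)" using False by auto
    moreover have "(\<forall>i\<in>{1..Suc N}. \<not> u i) \<longleftrightarrow> (\<forall>i\<in>{1..N}. \<not> u i)"
      using False by (auto simp: le_Suc_eq)
    ultimately show ?thesis using Suc.IH one by blast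
  qed
qed


lemma signed_perms_neg: "map (map_prod id Not) xs \<in> signed_perms n \<longleftrightarrow> xs \<in> signed_perms n"
  by (simp add: signed_perms_def image_image comp_def)

text \<open>The face of rank \<open>j\<close> consists of the entries with index below
  \<open>j\<close>, so it is the only face that separates the entries \<open>j - 1\<close> and
  \<open>j\<close>. The swap moves to the one other flag with the same faces at all other
  ranks.\<close>

lemma signed_perms_swap:
  assumes "xs \<in> signed_perms n" "0 < j" "j < n"
  defines "ys \<equiv> xs[j - 1 := xs ! j, j := xs ! (j - 1)]"
  shows "ys \<in> signed_perms n" "ys \<noteq> xs" "set ys = set xs"
    "\<And>i. i \<noteq> j \<Longrightarrow> set (take i ys) = set (take i xs)"
    "ys[j - 1 := ys ! j, j := ys ! (j - 1)] = xs"
proof -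
  have len: "length xs = n" by (rule length_signed_perms[OF assms(1)])
  have d: "distinct (map fst xs)" and s: "fst ` set xs = {..<n}"
    using assms(1) by (auto simp: signed_perms_def)
  have dx: "distinct xs" using d by (simp add: distinct_map)
  show set: "set ys = set xs"
    unfolding ys_def using assms len by (simp add: set_swap)
  have "map fst ys = (map fst xs)[j - 1 := map fst xs ! j, j := map fst xs ! (j - 1)]"
    unfolding ys_def using assms len by (simp add: map_update)
  then have "distinct (map fst ys)"
    using assms len d distinct_swap[of "j - 1" "map fst xs" j] by (simp del: list.map_comp distinct_swap)
  then show "ys \<in> signed_perms n" using set s by (simp add: signed_perms_def)
  have "ys ! j = xs ! (j - 1)" unfolding ys_def using assms len by simp
  moreover have "xs ! (j - 1) \<noteq> xs ! j" using dx assms len by (simp add: nth_eq_iff_index_eq)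
  ultimately show "ys \<noteq> xs" by auto
  show "set (take i ys) = set (take i xs)" if "i \<noteq> j" for i
  proof (cases "i < j")
    case True
    then show ?thesis unfolding ys_def by (simp add: take_update_cancel)
  next
    case False
    with that have ij: "j < i" by simp
    have "take i ys = (take i xs)[j - 1 := take i xs ! j, j := take i xs ! (j - 1)]"
      unfolding ys_def using ij by (simp add: take_update_swap)
    also have "set \<dots> = set (take i xs)"
      using assms len ij by (intro set_swap) auto
    finally show ?thesis .
  qed
  show "ys[j - 1 := ys ! j, j := ys ! (j - 1)] = xs"
    unfolding ys_def using assms len
    by (intro nth_equalityI) (auto simp: nth_list_update)
qed

text \<open>Changing the last sign alters only the face of full rank. The flag stays in a hemisphere
  fixed by the sign of one coordinate unless that coordinate comes last, which explains the
  exception in the fifth conclusion.\<close>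

lemma signed_perms_flip_last:
  assumes "xs \<in> signed_perms (Suc n)"
  defines "ys \<equiv> butlast xs @ [map_prod id Not (last xs)]"
  shows "ys \<in> signed_perms (Suc n)" "ys \<noteq> xs"
    "\<And>i. i < Suc n \<Longrightarrow> take i ys = take i xs"
    "butlast ys @ [map_prod id Not (last ys)] = xs"
    "\<And>z. z \<in> set xs \<Longrightarrow> fst z \<noteq> fst (last xs) \<Longrightarrow> z \<in> set ys"
    "fst (last ys) = fst (last xs)"
proof -
  have len: "length xs = Suc n" by (rule length_signed_perms[OF assms(1)])
  then obtain zs z where xs: "xs = zs @ [z]" by (metis length_Suc_conv_rev)
  have ys: "ys = zs @ [map_prod id Not z]" by (simp add: ys_def xs)
  show "ys \<in> signed_perms (Suc n)" using assms(1) by (simp add: signed_perms_def xs ys)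
  show "ys \<noteq> xs" by (cases z) (simp add: xs ys)
  show "\<And>i. i < Suc n \<Longrightarrow> take i ys = take i xs" using len by (simp add: xs ys)
  show "butlast ys @ [map_prod id Not (last ys)] = xs" by (cases z) (simp add: xs ys)
  show "\<And>w. w \<in> set xs \<Longrightarrow> fst w \<noteq> fst (last xs) \<Longrightarrow> w \<in> set ys" by (auto simp: xs ys)
  show "fst (last ys) = fst (last xs)" by (simp add: xs ys)
qed

text \<open>Dropping the last entry identifies the flags that end in coordinate \<open>n\<close>
  with the flags one dimension lower. These are the flags of the equator, to which the induction
  hypothesis applies.\<close>

lemma signed_perms_snoc_new:
  "zs @ [(n, b)] \<in> signed_perms (Suc n) \<longleftrightarrow> zs \<in> signed_perms n"
proof
  assume "zs \<in> signed_perms n"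
  then show "zs @ [(n, b)] \<in> signed_perms (Suc n)"
    by (auto simp: signed_perms_def lessThan_Suc)
next
  assume "zs @ [(n, b)] \<in> signed_perms (Suc n)"
  then have "distinct (map fst zs)" "n \<notin> fst ` set zs" "insert n (fst ` set zs) = insert n {..<n}"
    by (auto simp: signed_perms_def lessThan_Suc)
  then show "zs \<in> signed_perms n" unfolding signed_perms_def
    by (metis (mono_tags, lifting) insert_ident lessThan_iff less_irrefl mem_Collect_eq)
qed

text \<open>A case of Fan's lemma. In the hemisphere \<open>S\<close> of flags containing the sign \<open>(n, True)\<close>, count the
  pairs of a flag and a rank \<open>j\<close> such that \<open>U\<close> holds exactly below \<open>j\<close>, with no condition at \<open>j\<close>. The
  number per flag is odd iff \<open>U\<close> is constant on the flag. For fixed \<open>j \<le> n\<close> the flags cancel in pairs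
  that differ only at rank \<open>j\<close>; for \<open>j = n + 1\<close> the same happens except on the equator, where the
  induction hypothesis applies. Antipodality moves the constantly false flags to the other hemisphere.\<close>
lemma odd_card_all_true_chains:
  assumes antip: "\<And>X. finite X \<Longrightarrow> X \<noteq> {} \<Longrightarrow> inj_on fst X \<Longrightarrow> U (antipode X) \<longleftrightarrow> \<not> U X"
  shows "odd (card {xs \<in> signed_perms n. \<forall>i\<in>{1..n}. U (set (take i xs))})"
proof (induction n)
  case 0
  show ?case by (simp add: signed_perms_0 conj_disj_distribL cong: conj_cong)
next
  case (Suc n)
  define S where "S = {xs \<in> signed_perms (Suc n). (n, True) \<in> set xs}"
  define P where "P xs = {j\<in>{1..Suc n}. \<forall>i\<in>{1..Suc n}.
    (i < j \<longrightarrow> U (set (take i xs))) \<and> (j < i \<longrightarrow> \<not> U (set (take i xs)))}" for xs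
  define D where "D j = {xs \<in> S. j \<in> P xs}" for j
  define AT where "AT = {xs \<in> S. \<forall>i\<in>{1..Suc n}. U (set (take i xs))}"
  define AF where "AF = {xs \<in> S. \<forall>i\<in>{1..Suc n}. \<not> U (set (take i xs))}"
  have finS [simp]: "finite S" by (simp add: S_def)
  have fin [simp]: "finite AT" "finite AF" "finite (D j)" for j
    by (simp_all add: AT_def AF_def D_def)

  have count: "(\<Sum>xs\<in>S. card (P xs)) = (\<Sum>j\<in>{1..Suc n}. card (D j))"
  proof -
    have "card (P xs) = (\<Sum>j\<in>{1..Suc n}. if j \<in> P xs then 1 else 0)" for xs
      by (subst sum.inter_filter[symmetric]) (auto simp: P_def intro!: arg_cong[where f=card])
    moreover have "card (D j) = (\<Sum>xs\<in>S. if j \<in> P xs then 1 else 0)" for j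
      by (subst sum.inter_filter[symmetric]) (auto simp: D_def)
    ultimately show ?thesis by (simp only: sum.swap[of _ "{1..Suc n}" S])
  qed

  have "odd (card (P xs)) \<longleftrightarrow> xs \<in> AT \<union> AF" if "xs \<in> S" for xs
    unfolding P_def using odd_card_switch_points[of "Suc n" "\<lambda>i. U (set (take i xs))"] that
    by (auto simp: AT_def AF_def)
  then have "{xs \<in> S. odd (card (P xs))} = AT \<union> AF" by (auto simp: AT_def AF_def)
  then have lhs: "odd (\<Sum>xs\<in>S. card (P xs)) \<longleftrightarrow> odd (card (AT \<union> AF))"
    by (simp add: even_sum_iff)

  have inner: "even (card (D j))" if j: "j \<in> {1..n}" for j
  proof (rule even_card_involution)
    let ?f = "\<lambda>xs :: (nat \<times> bool) list. xs[j - 1 := xs ! j, j := xs ! (j - 1)]"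
    fix xs assume "xs \<in> D j"
    then have xs: "xs \<in> signed_perms (Suc n)" "(n, True) \<in> set xs" "j \<in> P xs"
      by (auto simp: D_def S_def)
    have jj: "0 < j" "j < Suc n" using j by auto
    note sw = signed_perms_swap[OF xs(1) jj]
    show "?f (?f xs) = xs" "?f xs \<noteq> xs" by (fact sw)+
    show "?f xs \<in> D j"
      using xs(3) sw(1,3,4) xs(2) unfolding D_def S_def P_def by auto
  qed simp

  have last: "odd (card (D (Suc n)))"
  proof -
    let ?E = "{xs \<in> D (Suc n). fst (last xs) = n}"
    let ?E' = "{xs \<in> D (Suc n). fst (last xs) \<noteq> n}"
    have DS: "D (Suc n) = {xs \<in> S. \<forall>i\<in>{1..n}. U (set (take i xs))}"
      by (auto simp: D_def P_def)
    have "even (card ?E')"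
    proof (rule even_card_involution)
      let ?f = "\<lambda>xs :: (nat \<times> bool) list. butlast xs @ [map_prod id Not (last xs)]"
      fix xs assume "xs \<in> ?E'"
      then have xs: "xs \<in> signed_perms (Suc n)" "(n, True) \<in> set xs" "fst (last xs) \<noteq> n"
        "\<forall>i\<in>{1..n}. U (set (take i xs))"
        by (auto simp: DS S_def)
      note fl = signed_perms_flip_last[OF xs(1)]
      show "?f (?f xs) = xs" "?f xs \<noteq> xs" by (fact fl)+
      show "?f xs \<in> ?E'"
        using fl(1,3,6) fl(5)[OF xs(2)] xs(3,4) unfolding DS S_def by auto
    qed simp
    moreover have "card (D (Suc n)) = card ?E + card ?E'"
      by (subst card_Un_disjoint[symmetric]) (auto intro: arg_cong[where f=card])
    moreover have "card ?E = card {xs \<in> signed_perms n. \<forall>i\<in>{1..n}. U (set (take i xs))}"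
    proof (rule bij_betw_same_card[symmetric])
      let ?C = "{xs \<in> signed_perms n. \<forall>i\<in>{1..n}. U (set (take i xs))}"
      let ?g = "\<lambda>zs. zs @ [(n, True)]"
      have "?E \<subseteq> ?g ` ?C"
      proof
        fix xs assume "xs \<in> ?E"
        then have xs: "xs \<in> signed_perms (Suc n)" "(n, True) \<in> set xs" "fst (last xs) = n"
          "\<forall>i\<in>{1..n}. U (set (take i xs))"
          by (auto simp: DS S_def)
        have len: "length xs = Suc n" using xs(1) by (rule length_signed_perms)
        then obtain zs z where z: "xs = zs @ [z]" by (metis length_Suc_conv_rev)
        have "z = (n, True)"
          using xs(1-3) unfolding z signed_perms_def by (cases z) force
        with z xs len signed_perms_snoc_new[of zs n True] show "xs \<in> ?g ` ?C" by auto
      qed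
      moreover have "?g ` ?C \<subseteq> ?E"
        using signed_perms_snoc_new[of _ n True]
        by (auto simp: DS S_def dest: length_signed_perms)
      ultimately show "bij_betw ?g ?C ?E" by (auto simp: bij_betw_def inj_on_def)
    qed
    ultimately show ?thesis using Suc.IH by simp
  qed

  have "{j \<in> {1..Suc n}. odd (card (D j))} = {Suc n}"
    using inner last by (auto simp: le_Suc_eq)
  then have "odd (\<Sum>j\<in>{1..Suc n}. card (D j))" by (subst even_sum_iff) simp_all
  with count lhs have oddU: "odd (card (AT \<union> AF))" by simp

  have "AT \<inter> AF = {}" by (auto simp: AT_def AF_def)
  then have c1: "card (AT \<union> AF) = card AT + card AF" by (simp add: card_Un_disjoint)
  let ?C = "{xs \<in> signed_perms (Suc n). \<forall>i\<in>{1..Suc n}. U (set (take i xs))}"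
  let ?N = "map (map_prod id Not)"
  define AG where "AG = {xs \<in> ?C. (n, False) \<in> set xs}"
  have nn: "?N (?N xs) = xs" for xs :: "(nat \<times> bool) list"
    by (simp add: comp_def map_prod_def case_prod_beta)
  have st: "set (take i (?N xs)) = antipode (set (take i xs))" for i xs
    by (simp add: antipode_def take_map)
  have "card AF = card AG"
  proof (rule bij_betw_same_card)
    have ne: "set (take i xs) \<noteq> {}" if "xs \<in> signed_perms (Suc n)" "i \<in> {1..Suc n}" for xs i
      using that length_signed_perms[of xs "Suc n"] by (cases xs; cases i) auto
    have inj: "inj_on fst (set (take i xs))" if "xs \<in> signed_perms (Suc n)" for xs i
      using that inj_on_subset[OF _ set_take_subset, of fst xs]
      by (auto simp: signed_perms_def distinct_map)
    have f1: "(n, False) \<in> set (?N xs)" if "(n, True) \<in> set xs" for xs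
      using that by force
    have f2: "(n, True) \<in> set (?N xs)" if "(n, False) \<in> set xs" for xs
      using that by force
    show "bij_betw ?N AF AG"
    proof (rule bij_betw_byWitness[where f' = ?N])
      show "?N ` AF \<subseteq> AG"
        using ne inj f1 unfolding AF_def AG_def S_def
        by (auto simp: signed_perms_neg st antip simp del: set_map)
      show "?N ` AG \<subseteq> AF"
        using ne inj f2 unfolding AF_def AG_def S_def
        by (auto simp: signed_perms_neg st antip simp del: set_map)
    qed (use nn in auto)
  qed
  moreover have "card ?C = card AT + card AG"
  proof -
    have "?C = AT \<union> AG"
    proof (intro equalityI subsetI)
      fix xs assume x: "xs \<in> ?C"
      then have "n \<in> fst ` set xs" by (auto simp: signed_perms_def)
      then obtain b where "(n, b) \<in> set xs" by auto
      then show "xs \<in> AT \<union> AG" using x by (cases b) (auto simp: AT_def AG_def S_def)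
    qed (auto simp: AT_def AG_def S_def)
    moreover have "AT \<inter> AG = {}"
    proof (rule ccontr)
      assume "AT \<inter> AG \<noteq> {}"
      then obtain xs where "distinct (map fst xs)" "(n, True) \<in> set xs" "(n, False) \<in> set xs"
        by (auto simp: AT_def AG_def S_def signed_perms_def)
      then show False by (metis eq_key_imp_eq_value)
    qed
    moreover have "finite AG" by (simp add: AG_def)
    ultimately show ?thesis by (simp add: card_Un_disjoint)
  qed
  ultimately show ?case using oddU c1 by simp
qed

text \<open>Give a signed set the sign of the side on which the largest colour of an \<open>m\<close>-subset of a side occurs.
  Along a flag with alternating signs, this largest colour strictly increases once the sides have
  at least \<open>2 * m - 1\<close> elements in total, which takes \<open>k + 2\<close> colours.\<close>
theorem kneser_monochromatic_pair:
  fixes c :: "nat set \<Rightarrow> nat"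
  assumes m: "m \<ge> 1"
    and col: "\<And>S. S \<subseteq> {..<2 * m + k} \<Longrightarrow> card S = m \<Longrightarrow> c S \<le> k"
  shows "\<exists>S T. S \<subseteq> {..<2 * m + k} \<and> T \<subseteq> {..<2 * m + k} \<and> card S = m \<and> card T = m \<and>
    S \<inter> T = {} \<and> c S = c T"
proof (rule ccontr)
  define n where "n = 2 * m + k"
  assume "\<not> ?thesis"
  then have proper: "c S \<noteq> c T" if "S \<subseteq> {..<n}" "T \<subseteq> {..<n}"
    "card S = m" "card T = m" "S \<inter> T = {}" for S T
    using that by (auto simp: n_def)
  define side where "side b X = {i. (i, b) \<in> X}" for b :: bool and X :: "(nat \<times> bool) set"
  define cols where "cols b X = c ` {S. S \<subseteq> side b X \<inter> {..<n} \<and> card S = m}" for b X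
  define big where "big X = Max (cols True X \<union> cols False X)" for X
  \<comment> \<open>The second branch serves signed sets without an \<open>m\<close>-set on either
    side. Any rule reversed by the antipode would do; the sign of the largest coordinate is
    one.\<close>
  define s where "s X \<longleftrightarrow>
    (if cols True X \<union> cols False X \<noteq> {} then big X \<in> cols True X
     else Max (fst ` X) \<in> side True X)" for X
  have side_disj: "side True X \<inter> side False X = {}" if "inj_on fst X" for X
    using that unfolding side_def inj_on_def by force
  have side_un: "side True X \<union> side False X = fst ` X" for X
  proof (rule set_eqI)
    fix i
    have "i \<in> fst ` X \<longleftrightarrow> (\<exists>b. (i, b) \<in> X)" by force
    then show "i \<in> side True X \<union> side False X \<longleftrightarrow> i \<in> fst ` X"
      by (simp add: side_def ex_bool_eq)
  qed
  \<comment> \<open>Two \<open>m\<close>-sets on opposite sides are disjoint, so properness forbids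
    them a common colour. Hence \<open>big X\<close> lies on exactly one side, and the antipode
    reverses \<open>s\<close>.\<close>
  have cols_disj: "cols True X \<inter> cols False X = {}" if "inj_on fst X" for X
  proof (rule ccontr)
    assume "cols True X \<inter> cols False X \<noteq> {}"
    then obtain S T where "S \<subseteq> side True X \<inter> {..<n}" "T \<subseteq> side False X \<inter> {..<n}"
      "card S = m" "card T = m" "c S = c T" by (auto simp: cols_def)
    then show False using proper[of S T] side_disj[OF that] by blast
  qed
  have fin_cols [simp]: "finite (cols b X)" for b X
    unfolding cols_def by (rule finite_imageI, rule finite_subset[of _ "Pow {..<n}"]) auto
  have big_mem: "big X \<in> cols True X \<union> cols False X" if "cols True X \<union> cols False X \<noteq> {}" for X
    unfolding big_def using that by (intro Max_in) auto
  have side_anti: "side b (antipode X) = side (\<not> b) X" for b X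
    unfolding side_def antipode_def by force
  have cols_anti: "cols b (antipode X) = cols (\<not> b) X" for b X
    by (simp add: cols_def side_anti)
  have s_anti: "s (antipode X) \<longleftrightarrow> \<not> s X" if "finite X" "X \<noteq> {}" "inj_on fst X" for X
  proof (cases "cols True X \<union> cols False X = {}")
    case True
    have f: "fst ` antipode X = fst ` X" by (simp add: antipode_def image_image)
    have "Max (fst ` X) \<in> fst ` X" using that by (intro Max_in) auto
    then have "Max (fst ` X) \<in> side False X \<longleftrightarrow> Max (fst ` X) \<notin> side True X"
      using side_disj[OF that(3)] side_un[of X] by blast
    then show ?thesis using True by (simp add: s_def cols_anti f side_anti)
  next
    case False
    have "big (antipode X) = big X" by (simp add: big_def cols_anti Un_commute)
    moreover have "big X \<in> cols False X \<longleftrightarrow> big X \<notin> cols True X"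
      using big_mem[OF False] cols_disj[OF that(3)] by blast
    ultimately show ?thesis using False by (auto simp: s_def cols_anti)
  qed
  \<comment> \<open>With this twist, flags of alternating sign become flags on which \<open>U\<close> is constant.\<close>
  define U where "U X \<longleftrightarrow> (s X \<longleftrightarrow> odd (card X))" for X
  have "card (antipode X) = card X" for X
    unfolding antipode_def by (rule card_image) (auto simp: inj_on_def)
  then have "odd (card {xs \<in> signed_perms n. \<forall>i\<in>{1..n}. U (set (take i xs))})"
    using s_anti by (intro odd_card_all_true_chains) (simp add: U_def)
  then have "{xs \<in> signed_perms n. \<forall>i\<in>{1..n}. U (set (take i xs))} \<noteq> {}"
    by (metis (no_types, lifting) card.empty even_zero)
  then obtain xs where xs: "xs \<in> signed_perms n" and Uxs: "\<And>i. i \<in> {1..n} \<Longrightarrow> U (set (take i xs))"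
    by blast
  define X where "X i = set (take i xs)" for i
  have len: "length xs = n" using xs by (rule length_signed_perms)
  have inj0: "inj_on fst (set xs)" and dist: "distinct xs"
    using xs by (auto simp: signed_perms_def distinct_map)
  have inj: "inj_on fst (X i)" for i
    unfolding X_def using inj0 set_take_subset by (rule inj_on_subset)
  have cardX: "card (X i) = i" if "i \<le> n" for i
    using that dist len by (simp add: X_def distinct_card)
  have fstX: "fst ` X i \<subseteq> {..<n}" for i
    using xs set_take_subset[of i xs] by (auto simp: X_def signed_perms_def)
  have sX: "s (X i) \<longleftrightarrow> odd i" if "i \<in> {1..n}" for i
    using Uxs[OF that] cardX[of i] that by (auto simp: U_def X_def)
  have ne: "cols True (X i) \<union> cols False (X i) \<noteq> {}" if "i \<in> {2 * m - 1..n}" for i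
  proof -
    have finb: "finite (side b (X i))" and subb: "side b (X i) \<subseteq> {..<n}" for b
    proof -
      have "side b (X i) \<subseteq> fst ` X i" by (force simp: side_def)
      then show "side b (X i) \<subseteq> {..<n}" using fstX by blast
      then show "finite (side b (X i))" by (rule finite_subset) simp
    qed
    have "card (side True (X i)) + card (side False (X i)) = card (fst ` X i)"
      using finb side_disj[OF inj] by (simp add: card_Un_disjoint side_un[symmetric])
    also have "\<dots> = i" using inj that cardX by (simp add: card_image)
    finally have sum: "card (side True (X i)) + card (side False (X i)) = i" .
    have "\<exists>b. m \<le> card (side b (X i))"
    proof (rule ccontr)
      assume "\<not> ?thesis"
      then have "card (side True (X i)) < m" "card (side False (X i)) < m" by (simp_all add: not_le)
      then show False using sum that by auto
    qed
    then obtain b S where "S \<subseteq> side b (X i)" "card S = m"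
      by (meson obtain_subset_with_card_n)
    then have "c S \<in> cols b (X i)" using subb by (auto simp: cols_def)
    then show ?thesis by (cases b) auto
  qed
  \<comment> \<open>Colours persist along the flag, so an unchanged maximum would keep its side,
    whereas the sign alternates with the rank.\<close>
  have step: "big (X i) < big (X (Suc i))" if "2 * m - 1 \<le> i" "i < n" for i
  proof -
    have sub: "cols b (X i) \<subseteq> cols b (X (Suc i))" for b
      using set_take_subset_set_take[of i "Suc i" xs] by (auto simp: cols_def side_def X_def)
    have n1: "cols True (X i) \<union> cols False (X i) \<noteq> {}"
      and n2: "cols True (X (Suc i)) \<union> cols False (X (Suc i)) \<noteq> {}" using ne that by auto
    have "big (X i) \<le> big (X (Suc i))"
      unfolding big_def using n1 sub[of True] sub[of False] by (intro Max_mono) auto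
    moreover have "big (X i) \<noteq> big (X (Suc i))"
    proof
      assume eq: "big (X i) = big (X (Suc i))"
      have "big (X i) \<in> cols True (X i) \<longleftrightarrow> odd i"
        using sX[of i] n1 that m by (auto simp: s_def simp del: Un_empty)
      moreover have "big (X i) \<in> cols True (X (Suc i)) \<longleftrightarrow> even i"
        using sX[of "Suc i"] n2 that m by (auto simp: s_def eq simp del: Un_empty)
      ultimately show False
        using big_mem[OF n1] sub[of True] sub[of False] cols_disj[OF inj, of "Suc i"] by blast
    qed
    ultimately show ?thesis by simp
  qed
  \<comment> \<open>Between the ranks \<open>2 * m - 1\<close> and \<open>n = 2 * m + k\<close>
    there are \<open>k + 1\<close> strict increases, so the maximum reaches \<open>k + 1\<close>,
    one beyond the palette \<open>0, ..., k\<close>.\<close>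
  have "j \<le> k + 1 \<longrightarrow> j \<le> big (X (2 * m - 1 + j))" for j
  proof (induction j)
    case (Suc j)
    have "big (X (2 * m - 1 + j)) < big (X (Suc (2 * m - 1 + j)))" if "j \<le> k"
      using that m by (intro step) (auto simp: n_def)
    then show ?case using Suc.IH by fastforce
  qed simp
  moreover have "2 * m - 1 + (k + 1) = n" using m by (simp add: n_def)
  ultimately have "k + 1 \<le> big (X n)" by (metis order_refl)
  moreover have "big (X n) \<in> cols True (X n) \<union> cols False (X n)"
    using m by (intro big_mem ne) (auto simp: n_def)
  then have "big (X n) \<le> k" using col by (auto simp: cols_def n_def)
  ultimately show False by simp
qed

section \<open>Dense triangle-free graphs of large chromatic number\<close>

text \<open>The vertices are \<open>0, \<dots>, M - 1\<close>; the random graph meets a blow-up of such a graph in the \<open>H\<close>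
  of part (i).\<close>
definition dense_obstruction :: "nat \<Rightarrow> real \<Rightarrow> nat \<Rightarrow> (nat \<Rightarrow> nat \<Rightarrow> bool) \<Rightarrow> bool" where
  "dense_obstruction q \<theta> M R \<longleftrightarrow> M \<ge> 1 \<and> (\<forall>x y. R x y \<longrightarrow> R y x) \<and>
     (\<forall>x y z. R x y \<longrightarrow> R y z \<longrightarrow> \<not> R x z) \<and>
     (\<forall>x<M. \<theta> * M \<le> card {y. y < M \<and> R x y}) \<and>
     (\<forall>c::nat \<Rightarrow> nat. (\<forall>x<M. c x < q) \<longrightarrow> (\<exists>x<M. \<exists>y<M. R x y \<and> c x = c y))"

text \<open>Each vertex \<open>v\<close> becomes \<open>w v\<close> pairwise non-adjacent copies,
  which turns weighted degrees into degrees and creates no triangle. Positive weights leave a copy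
  \<open>(v, 0)\<close> of every vertex, and a colouring of the copies is tested on these
  representatives.\<close>

lemma dense_obstruction_of_weighted:
  fixes w :: "'v \<Rightarrow> nat"
  assumes fin: "finite V" and ne: "V \<noteq> {}" and w: "\<And>v. v \<in> V \<Longrightarrow> w v \<ge> 1"
    and sym: "\<And>x y. x \<in> V \<Longrightarrow> y \<in> V \<Longrightarrow> R x y \<Longrightarrow> R y x"
    and tri: "\<And>x y z. x \<in> V \<Longrightarrow> y \<in> V \<Longrightarrow> z \<in> V \<Longrightarrow> R x y \<Longrightarrow> R y z \<Longrightarrow> \<not> R x z"
    and deg: "\<And>v. v \<in> V \<Longrightarrow> \<theta> * real (\<Sum>u\<in>V. w u) \<le> real (\<Sum>u\<in>{u \<in> V. R v u}. w u)"
    and col: "\<And>c::'v \<Rightarrow> nat. (\<And>x. x \<in> V \<Longrightarrow> c x < q) \<Longrightarrow> \<exists>x\<in>V. \<exists>y\<in>V. R x y \<and> c x = c y"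
  shows "\<exists>M R. dense_obstruction q \<theta> M R"
proof -
  define P where "P = Sigma V (\<lambda>v. {..<w v})"
  define M where "M = card P"
  have finP: "finite P" using fin by (simp add: P_def)
  have cardP: "M = (\<Sum>u\<in>V. w u)" using fin by (simp add: M_def P_def)
  obtain h where h: "bij_betw h {..<M} P"
    using ex_bij_betw_nat_finite[OF finP] by (auto simp: M_def atLeast0LessThan)
  define g where "g x = fst (h x)" for x
  define R' where "R' x y \<longleftrightarrow> x < M \<and> y < M \<and> R (g x) (g y)" for x y
  have hP: "h x \<in> P" if "x < M" for x using h that by (auto simp: bij_betw_def)
  have gV: "g x \<in> V" if "x < M" for x using hP[OF that] by (auto simp: P_def g_def)
  have "dense_obstruction q \<theta> M R'"
    unfolding dense_obstruction_def
  proof (intro conjI allI impI)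
    obtain v where "v \<in> V" using ne by blast
    then have "(v, 0) \<in> P" using w[of v] by (auto simp: P_def)
    then show "1 \<le> M" using finP card_gt_0_iff[of P] unfolding M_def by fastforce
  next
    fix x y assume "R' x y" then show "R' y x" using gV sym[of "g x" "g y"] by (simp add: R'_def)
  next
    fix x y z assume "R' x y" "R' y z"
    then show "\<not> R' x z" using gV tri[of "g x" "g y" "g z"] by (simp add: R'_def)
  next
    fix x assume x: "x < M"
    have "P = h ` {..<M}" using h by (simp add: bij_betw_def)
    then have "h ` {y. y < M \<and> R' x y} = {p \<in> P. R (g x) (fst p)}"
      using x by (auto simp: R'_def g_def)
    moreover have "inj_on h {y. y < M \<and> R' x y}"
      using bij_betw_imp_inj_on[OF h] by (rule inj_on_subset) auto
    then have "card (h ` {y. y < M \<and> R' x y}) = card {y. y < M \<and> R' x y}" by (rule card_image)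
    ultimately have "card {y. y < M \<and> R' x y} = card {p \<in> P. R (g x) (fst p)}" by simp
    also have "{p \<in> P. R (g x) (fst p)} = Sigma {u \<in> V. R (g x) u} (\<lambda>u. {..<w u})"
      by (auto simp: P_def)
    also have "card \<dots> = (\<Sum>u\<in>{u \<in> V. R (g x) u}. w u)" using fin by simp
    finally show "\<theta> * real M \<le> real (card {y. y < M \<and> R' x y})"
      using deg[OF gV[OF x]] by (simp add: cardP)
  next
    fix c :: "nat \<Rightarrow> nat" assume c: "\<forall>x<M. c x < q"
    define k where "k v = the_inv_into {..<M} h (v, 0)" for v
    have k: "k v < M" "g (k v) = v" if "v \<in> V" for v
    proof -
      have "(v, 0) \<in> P" using w[OF that] that by (auto simp: P_def)
      then have im: "(v, 0) \<in> h ` {..<M}" using h by (simp add: bij_betw_def)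
      note inj = bij_betw_imp_inj_on[OF h]
      show "k v < M" using the_inv_into_into[OF inj im order_refl] by (simp add: k_def)
      show "g (k v) = v" using f_the_inv_into_f[OF inj im] by (simp add: k_def g_def)
    qed
    have "\<exists>x\<in>V. \<exists>y\<in>V. R x y \<and> c (k x) = c (k y)"
      using c k(1) by (intro col) blast
    then obtain x y where xy: "x \<in> V" "y \<in> V" "R x y" "c (k x) = c (k y)" by blast
    then have "R' (k x) (k y)" using k[OF xy(1)] k[OF xy(2)] by (simp add: R'_def)
    then show "\<exists>x<M. \<exists>y<M. R' x y \<and> c x = c y"
      using k(1)[OF xy(1)] k(1)[OF xy(2)] xy(4) by blast
  qed
  then show ?thesis by blast
qed

text \<open>For explicit graphs every requirement except the one on colourings becomes a finite
  check on lists, settled by evaluation. All weighted degrees are to equal \<open>d\<close>.\<close>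

lemma dense_obstruction_of_neighbour_lists:
  fixes N :: "nat list list" and w :: "nat \<Rightarrow> nat"
  assumes ne: "N \<noteq> []"
    and chk: "\<forall>x\<in>set [0..<length N]. w x \<ge> 1 \<and> distinct (N ! x) \<and> sum_list (map w (N ! x)) = d \<and>
      (\<forall>y\<in>set (N ! x). y < length N \<and> x \<in> set (N ! y) \<and> (\<forall>z\<in>set (N ! y). z \<notin> set (N ! x)))"
    and tot: "sum_list (map w [0..<length N]) = t"
    and col: "\<And>c::nat \<Rightarrow> nat. (\<And>x. x < length N \<Longrightarrow> c x < q) \<Longrightarrow>
      \<exists>x<length N. \<exists>y\<in>set (N ! x). c x = c y"
  shows "\<exists>M R. dense_obstruction q (d / t) M R"
proof (rule dense_obstruction_of_weighted[where V = "set [0..<length N]" and w = w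
      and R = "\<lambda>x y. y \<in> set (N ! x)"])
  show "y \<in> set (N ! x) \<Longrightarrow> x \<in> set (N ! y)" if "x \<in> set [0..<length N]" for x y
    using bspec[OF chk that] by blast
  show "y \<in> set (N ! x) \<Longrightarrow> z \<in> set (N ! y) \<Longrightarrow> z \<notin> set (N ! x)" if "x \<in> set [0..<length N]" for x y z
    using bspec[OF chk that] by blast
  show "w v \<ge> 1" if "v \<in> set [0..<length N]" for v
    using bspec[OF chk that] by simp
  have t: "(\<Sum>u\<in>set [0..<length N]. w u) = t"
    using tot by (subst sum.distinct_set_conv_list) simp_all
  have 0: "0 \<in> set [0..<length N]" using ne by simp
  moreover have "1 \<le> w 0" using bspec[OF chk 0] by simp
  ultimately have "t > 0" unfolding t[symmetric]
    using member_le_sum[of 0 "set [0..<length N]" w] by simp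
  fix v :: nat assume v: "v \<in> set [0..<length N]"
  have "{u \<in> set [0..<length N]. u \<in> set (N ! v)} = set (N ! v)"
    using chk[rule_format, OF v] by auto
  then have "(\<Sum>u\<in>{u \<in> set [0..<length N]. u \<in> set (N ! v)}. w u) = d"
    using chk[rule_format, OF v] sum.distinct_set_conv_list[of "N ! v" w] by simp
  then show "d / t * real (\<Sum>u\<in>set [0..<length N]. w u)
      \<le> real (\<Sum>u\<in>{u \<in> set [0..<length N]. u \<in> set (N ! v)}. w u)"
    using t \<open>t > 0\<close> by simp
next
  fix c :: "nat \<Rightarrow> nat" assume "\<And>x. x \<in> set [0..<length N] \<Longrightarrow> c x < q"
  then obtain x y where "x < length N" "y \<in> set (N ! x)" "c x = c y" using col[of c] by auto
  moreover from this have "y < length N" using bspec[OF chk, of x] by simp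
  ultimately show "\<exists>x\<in>set [0..<length N]. \<exists>y\<in>set [0..<length N]. y \<in> set (N ! x) \<and> c x = c y"
    by (intro bexI[of _ x] bexI[of _ y]) auto
qed (use ne in auto)

section \<open>Explicit obstructions to two and three colours\<close>

definition pentagon_neighbours :: "nat list list" where
  "pentagon_neighbours = [[1,4],[0,2],[1,3],[2,4],[0,3]]"

lemma pentagon_obstruction: "\<exists>M R. dense_obstruction 2 (2/5) M R"
proof -
  let ?N = pentagon_neighbours
  have col: "\<exists>x<length ?N. \<exists>y\<in>set (?N ! x). c x = c y"
    if c: "\<And>x. x < length ?N \<Longrightarrow> c x < 2" for c :: "nat \<Rightarrow> nat"
  proof (rule ccontr)
    assume "\<not> ?thesis"
    then have p: "c x \<noteq> c y" if "x < length ?N" "y \<in> set (?N ! x)" for x y using that by blast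
    have "c 0 \<noteq> c 1" "c 1 \<noteq> c 2" "c 2 \<noteq> c 3" "c 3 \<noteq> c 4" "c 4 \<noteq> c 0"
      by (rule p; simp add: pentagon_neighbours_def)+
    moreover have "c x = 0 \<longleftrightarrow> c x \<noteq> 1" if "x < length ?N" for x
      using c[OF that] by linarith
    then have "c 0 = 0 \<longleftrightarrow> c 0 \<noteq> 1" "c 1 = 0 \<longleftrightarrow> c 1 \<noteq> 1" "c 2 = 0 \<longleftrightarrow> c 2 \<noteq> 1"
      "c 3 = 0 \<longleftrightarrow> c 3 \<noteq> 1" "c 4 = 0 \<longleftrightarrow> c 4 \<noteq> 1"
      by (simp_all add: pentagon_neighbours_def)
    ultimately show False by metis
  qed
  have "\<exists>M R. dense_obstruction 2 (real 2 / real 5) M R"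
  proof (rule dense_obstruction_of_neighbour_lists[where w = "\<lambda>_. 1", OF _ _ _ col])
    show "?N \<noteq> []" by (simp add: pentagon_neighbours_def)
    show "\<forall>x\<in>set [0..<length ?N]. (1::nat) \<le> 1 \<and> distinct (?N ! x) \<and>
      sum_list (map (\<lambda>_. 1) (?N ! x)) = (2::nat) \<and>
      (\<forall>y\<in>set (?N ! x). y < length ?N \<and> x \<in> set (?N ! y) \<and> (\<forall>z\<in>set (?N ! y). z \<notin> set (?N ! x)))"
      by code_simp
    show "sum_list (map (\<lambda>_. 1) [0..<length ?N]) = (5::nat)" by code_simp
  qed
  then show ?thesis by simp
qed

text \<open>Vertex \<open>i < 5\<close> is on the pentagon, \<open>5 + i\<close> is its twin and \<open>10\<close> is the apex.\<close>
definition groetzsch_neighbours :: "nat list list" where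
  "groetzsch_neighbours = [[1,4,6,9],[0,2,5,7],[1,3,6,8],[2,4,7,9],[0,3,5,8],
     [1,4,10],[0,2,10],[1,3,10],[2,4,10],[0,3,10],[5,6,7,8,9]]"

text \<open>The weights make the graph regular: \<open>2 * 3 + 2 * 2\<close>,
  \<open>2 * 3 + 4\<close> and \<open>5 * 2\<close> all equal 10, while the total is
  \<open>5 * 3 + 5 * 2 + 4 = 29\<close>.\<close>

definition groetzsch_weight :: "nat \<Rightarrow> nat" where
  "groetzsch_weight x = (if x < 5 then 3 else if x < 10 then 2 else 4)"

lemma groetzsch_not_3_colourable:
  fixes c :: "nat \<Rightarrow> nat"
  assumes "\<And>x. x < length groetzsch_neighbours \<Longrightarrow> c x < 3"
  shows "\<exists>x<length groetzsch_neighbours. \<exists>y\<in>set (groetzsch_neighbours ! x). c x = c y"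
proof (rule ccontr)
  assume "\<not> ?thesis"
  then have p: "c x \<noteq> c y" if "x < length groetzsch_neighbours" "y \<in> set (groetzsch_neighbours ! x)" for x y using that by blast
  have cyc: "c 0 \<noteq> c 1" "c 1 \<noteq> c 2" "c 2 \<noteq> c 3" "c 3 \<noteq> c 4" "c 4 \<noteq> c 0"
    and twin: "c 5 \<noteq> c 1" "c 5 \<noteq> c 4" "c 6 \<noteq> c 2" "c 6 \<noteq> c 0" "c 7 \<noteq> c 3" "c 7 \<noteq> c 1"
      "c 8 \<noteq> c 4" "c 8 \<noteq> c 2" "c 9 \<noteq> c 0" "c 9 \<noteq> c 3"
    and apex: "c 10 \<noteq> c 5" "c 10 \<noteq> c 6" "c 10 \<noteq> c 7" "c 10 \<noteq> c 8" "c 10 \<noteq> c 9"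
    by (rule p; simp add: groetzsch_neighbours_def)+
  \<comment> \<open>Recolouring by the twin wherever the apex colour occurs would 2-colour the pentagon.\<close>
  define d where "d i = (if c i = c 10 then c (5 + i) else c i)" for i
  \<comment> \<open>Two neighbours on the pentagon cannot both carry the apex colour, and a twin is
    joined to the same pentagon vertices as its original, so recolouring one end keeps the edge
    proper.\<close>
  have d: "d 0 \<noteq> d 1" "d 1 \<noteq> d 2" "d 2 \<noteq> d 3" "d 3 \<noteq> d 4" "d 4 \<noteq> d 0"
    using cyc twin by (auto simp: d_def)
  have da: "d 0 \<noteq> c 10" "d 1 \<noteq> c 10" "d 2 \<noteq> c 10" "d 3 \<noteq> c 10" "d 4 \<noteq> c 10"
    using apex by (auto simp: d_def)
  have d3: "d 0 < 3" "d 1 < 3" "d 2 < 3" "d 3 < 3" "d 4 < 3" "c 10 < 3"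
    using assms by (auto simp: d_def groetzsch_neighbours_def)
  \<comment> \<open>One of the two colours left for \<open>d\<close>. Being equal to
    \<open>x\<close> would have to alternate around a cycle of odd length.\<close>
  define x where "x = (if c 10 = 0 then 1 else (0::nat))"
  have "x < 3" "x \<noteq> c 10" by (auto simp: x_def)
  then have flip: "d i = x \<longleftrightarrow> d j \<noteq> x"
    if "d i \<noteq> d j" "d i \<noteq> c 10" "d j \<noteq> c 10" "d i < 3" "d j < 3" for i j
    using that \<open>c 10 < 3\<close> by linarith
  show False
    using flip[OF d(1) da(1,2) d3(1,2)] flip[OF d(2) da(2,3) d3(2,3)] flip[OF d(3) da(3,4) d3(3,4)]
      flip[OF d(4) da(4,5) d3(4,5)] flip[OF d(5) da(5,1) d3(5,1)] by simp
qed

lemma groetzsch_obstruction: "\<exists>M R. dense_obstruction 3 (10/29) M R"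
proof -
  have "\<exists>M R. dense_obstruction 3 (real 10 / real 29) M R"
  proof (rule dense_obstruction_of_neighbour_lists[OF _ _ _ groetzsch_not_3_colourable])
    show "groetzsch_neighbours \<noteq> []" by (simp add: groetzsch_neighbours_def)
    show "\<forall>x\<in>set [0..<length groetzsch_neighbours]. groetzsch_weight x \<ge> 1 \<and>
      distinct (groetzsch_neighbours ! x) \<and>
      sum_list (map groetzsch_weight (groetzsch_neighbours ! x)) = 10 \<and>
      (\<forall>y\<in>set (groetzsch_neighbours ! x). y < length groetzsch_neighbours \<and>
        x \<in> set (groetzsch_neighbours ! y) \<and>
        (\<forall>z\<in>set (groetzsch_neighbours ! y). z \<notin> set (groetzsch_neighbours ! x)))"
      by code_simp
    show "sum_list (map groetzsch_weight [0..<length groetzsch_neighbours]) = 29"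
      by code_simp
  qed
  then show ?thesis by simp
qed

text \<open>Hajnal's construction: the vertices are the \<open>m\<close>-subsets of a ground set, the points of the
  ground set, and one further vertex joined to all points.\<close>
fun hajnal_adj :: "nat set + nat option \<Rightarrow> nat set + nat option \<Rightarrow> bool" where
  "hajnal_adj (Inl S) (Inl T) \<longleftrightarrow> S \<inter> T = {}"
| "hajnal_adj (Inl S) (Inr (Some i)) \<longleftrightarrow> i \<in> S"
| "hajnal_adj (Inr (Some i)) (Inl S) \<longleftrightarrow> i \<in> S"
| "hajnal_adj (Inr (Some i)) (Inr None) \<longleftrightarrow> True"
| "hajnal_adj (Inr None) (Inr (Some i)) \<longleftrightarrow> True"
| "hajnal_adj _ _ \<longleftrightarrow> False"

lemma no_three_disjoint_large_subsets:
  assumes "finite V" "S \<subseteq> V" "T \<subseteq> V" "W \<subseteq> V" "S \<inter> T = {}" "T \<inter> W = {}" "S \<inter> W = {}"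
  shows "card S + card T + card W \<le> card V"
proof -
  have fin: "finite S" "finite T" "finite W" using assms finite_subset by blast+
  have "(S \<union> T) \<inter> W = {}" using assms by blast
  then have "card S + card T + card W = card (S \<union> T \<union> W)"
    using assms fin by (simp add: card_Un_disjoint)
  also have "\<dots> \<le> card V" using assms by (intro card_mono) auto
  finally show ?thesis .
qed

text \<open>Up to small terms the points carry two thirds of the weight, the extra vertex one third
  and the \<open>m\<close>-sets nothing. A set sees its \<open>m\<close> points, nearly half of them
  all; a point sees the extra vertex; the extra vertex sees all points. So each sees about a third
  of the total or more.\<close>

lemma hajnal_obstruction:
  assumes q: "q \<ge> 1" and \<epsilon>: "(\<epsilon>::real) > 0"
  shows "\<exists>M R. dense_obstruction q (1/3 - \<epsilon>) M R"
proof -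
  \<comment> \<open>The colours below \<open>q\<close> are then \<open>0, ..., k\<close>, one fewer
    than the Kneser graph requires.\<close>
  define k where "k = q - 1"
  \<comment> \<open>\<open>m > k\<close> excludes three disjoint \<open>m\<close>-sets among
    \<open>2 * m + k\<close> points. The first summand gives
    \<open>k \<le> 2 * \<epsilon> * n\<close>, which controls the loss from a set seeing slightly
    less than half of the points.\<close>
  define m where "m = nat \<lceil>k / (2 * \<epsilon>)\<rceil> + k + 1"
  define n where "n = 2 * m + k"
  define K where "K = {S. S \<subseteq> {..<n} \<and> card S = m}"
  \<comment> \<open>Chosen so that the total weight \<open>card K\<close> of the sets is at most
    \<open>3 * \<epsilon> * L * n\<close>, small against \<open>3 * L * n\<close>.\<close>
  define L where "L = nat \<lceil>card K / (3 * \<epsilon>)\<rceil> + 1"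
  have finK: "finite K" unfolding K_def by (rule finite_subset[of _ "Pow {..<n}"]) auto
  have m: "m > k" "m \<ge> 1" by (auto simp: m_def)
  have "k / (2 * \<epsilon>) \<le> m" unfolding m_def by linarith
  also have "real m \<le> n" by (simp add: n_def)
  finally have kn: "k \<le> 2 * \<epsilon> * n" using \<epsilon> by (simp add: field_simps)
  have "card K / (3 * \<epsilon>) \<le> L" unfolding L_def by linarith
  then have "card K \<le> 3 * \<epsilon> * L" using \<epsilon> by (simp add: field_simps)
  also have "\<dots> \<le> 3 * \<epsilon> * L * n"
    using mult_left_mono[of 1 "real n" "3 * \<epsilon> * L"] \<epsilon> m by (simp add: n_def)
  finally have KL: "card K \<le> 3 * (\<epsilon> * L * n)" by (simp add: algebra_simps)
  let ?V = "Inl ` K \<union> Inr ` Some ` {..<n} \<union> {Inr None}"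
  define w :: "nat set + nat option \<Rightarrow> nat" where
    "w v = (case v of Inl S \<Rightarrow> 1 | Inr (Some i) \<Rightarrow> 2 * L | Inr None \<Rightarrow> L * n)" for v
  have tot: "(\<Sum>v\<in>?V. w v) = card K + 3 * L * n"
  proof -
    have "(\<Sum>v\<in>?V. w v) = (\<Sum>v\<in>Inl ` K. w v) + (\<Sum>v\<in>Inr ` Some ` {..<n}. w v) + w (Inr None)"
      using finK by (subst sum.union_disjoint, auto)+
    then show ?thesis by (simp add: sum.reindex w_def)
  qed
  have bound: "(1/3 - \<epsilon>) * (\<Sum>v\<in>?V. w v) \<le> L * n - 2 * (\<epsilon> * L * n)"
  proof -
    have "(1/3 - \<epsilon>) * (\<Sum>v\<in>?V. w v) = L * n - 3 * (\<epsilon> * L * n) + card K / 3 - \<epsilon> * card K"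
      unfolding tot by (simp add: algebra_simps)
    moreover have "\<epsilon> * card K \<ge> 0" using \<epsilon> by simp
    ultimately show ?thesis using KL by linarith
  qed
  have e0: "\<epsilon> * L * n \<ge> 0" using \<epsilon> by simp
  show ?thesis
  proof (rule dense_obstruction_of_weighted[where V = ?V and w = w and R = hajnal_adj])
    show "finite ?V" using finK by simp
    show "?V \<noteq> {}" by simp
    show "1 \<le> w v" if "v \<in> ?V" for v
      using that m by (auto simp: w_def L_def n_def)
    show "hajnal_adj y x" if "hajnal_adj x y" for x y
      using that by (cases "(x, y)" rule: hajnal_adj.cases) auto
    show "\<not> hajnal_adj x z" if xyz: "x \<in> ?V" "y \<in> ?V" "z \<in> ?V" "hajnal_adj x y" "hajnal_adj y z" for x y z
    proof
      assume xz: "hajnal_adj x z"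
      have "\<exists>S T W. x = Inl S \<and> y = Inl T \<and> z = Inl W"
      proof (cases x)
        case (Inl S)
        with xyz xz show ?thesis by (cases y; cases z) (auto elim!: option.exhaust)
      next
        case (Inr a)
        with xyz xz show ?thesis by (cases y; cases z; cases a) auto
      qed
      then obtain S T W where eq: "x = Inl S" "y = Inl T" "z = Inl W" by blast
      then have "S \<in> K" "T \<in> K" "W \<in> K" using xyz(1-3) by auto
      then have "card S + card T + card W \<le> card {..<n}" "card S = m" "card T = m" "card W = m"
        using xyz(4,5) xz eq no_three_disjoint_large_subsets[of "{..<n}" S T W] by (auto simp: K_def)
      then show False using m by (simp add: n_def)
    qed
    fix v assume v: "v \<in> ?V"
    have part: "real (\<Sum>u\<in>A. w u) \<le> real (\<Sum>u\<in>{u \<in> ?V. hajnal_adj v u}. w u)"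
      if "A \<subseteq> {u \<in> ?V. hajnal_adj v u}" for A
      using that finK by (intro of_nat_mono sum_mono2) auto
    consider S where "v = Inl S" "S \<in> K" | i where "v = Inr (Some i)" | "v = Inr None"
      using v by auto
    then have "L * n - 2 * (\<epsilon> * L * n) \<le> real (\<Sum>u\<in>{u \<in> ?V. hajnal_adj v u}. w u)"
    proof cases
      case 1
      have "real (\<Sum>u\<in>Inr ` Some ` S. w u) = 2 * L * m"
        using 1 by (simp add: sum.reindex w_def K_def)
      moreover have "real (\<Sum>u\<in>Inr ` Some ` S. w u) \<le> real (\<Sum>u\<in>{u \<in> ?V. hajnal_adj v u}. w u)"
        using 1 by (intro part) (auto simp: K_def)
      ultimately have "2 * L * m \<le> real (\<Sum>u\<in>{u \<in> ?V. hajnal_adj v u}. w u)"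
        by linarith
      moreover have "real L * k \<le> L * (2 * \<epsilon> * n)" using kn by (rule mult_left_mono) simp
      then have "L * n - 2 * (\<epsilon> * L * n) \<le> 2 * L * real m"
        by (simp add: n_def algebra_simps)
      ultimately show ?thesis by simp
    next
      case 2
      then have "real (\<Sum>u\<in>{Inr None}. w u) \<le> real (\<Sum>u\<in>{u \<in> ?V. hajnal_adj v u}. w u)"
        by (intro part) auto
      then show ?thesis using e0 by (simp add: w_def)
    next
      case 3
      then have "real (\<Sum>u\<in>Inr ` Some ` {..<n}. w u) \<le> real (\<Sum>u\<in>{u \<in> ?V. hajnal_adj v u}. w u)"
        by (intro part) auto
      moreover have "real (\<Sum>u\<in>Inr ` Some ` {..<n}. w u) = 2 * (real L * n)"
        by (simp add: sum.reindex w_def)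
      moreover have "real L * n \<ge> 0" by simp
      ultimately show ?thesis using e0 unfolding of_nat_mult by linarith
    qed
    then show "(1/3 - \<epsilon>) * real (\<Sum>u\<in>?V. w u) \<le> real (\<Sum>u\<in>{u \<in> ?V. hajnal_adj v u}. w u)"
      using bound by linarith
  next
    fix c :: "nat set + nat option \<Rightarrow> nat"
    assume c: "\<And>x. x \<in> ?V \<Longrightarrow> c x < q"
    have "\<exists>S T. S \<subseteq> {..<2 * m + k} \<and> T \<subseteq> {..<2 * m + k} \<and> card S = m \<and> card T = m \<and>
      S \<inter> T = {} \<and> c (Inl S) = c (Inl T)"
    proof (rule kneser_monochromatic_pair[OF m(2)])
      fix S assume "S \<subseteq> {..<2 * m + k}" "card S = m"
      then have "c (Inl S) < q" by (intro c) (auto simp: K_def n_def)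
      then show "c (Inl S) \<le> k" by (simp add: k_def)
    qed
    then obtain S T where "S \<in> K" "T \<in> K" "S \<inter> T = {}" "c (Inl S) = c (Inl T)"
      by (auto simp: K_def n_def)
    then show "\<exists>x\<in>?V. \<exists>y\<in>?V. hajnal_adj x y \<and> c x = c y"
      by (intro bexI[of _ "Inl S"] bexI[of _ "Inl T"]) auto
  qed
qed

section \<open>Tail bounds\<close>

abbreviation bernoulli_family :: "'a set \<Rightarrow> real \<Rightarrow> ('a \<Rightarrow> bool) pmf" where
  "bernoulli_family E p \<equiv> Pi_pmf E False (\<lambda>_. bernoulli_pmf p)"

lemma finite_set_bernoulli_family: "finite E \<Longrightarrow> finite (set_pmf (bernoulli_family E p))"
  by (simp add: set_Pi_pmf finite_PiE_dflt)

lemma prob_le_expectation: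
  fixes g :: "'a \<Rightarrow> real"
  assumes "finite (set_pmf D)" "\<And>x. g x \<ge> 0" "\<And>x. x \<in> A \<Longrightarrow> g x \<ge> 1"
  shows "measure_pmf.prob D A \<le> measure_pmf.expectation D g"
proof -
  have "measure_pmf.prob D A = measure_pmf.expectation D (indicator A)" by simp
  also have "\<dots> \<le> measure_pmf.expectation D g"
    using assms by (intro integral_mono integrable_measure_pmf_finite) (auto simp: indicator_def)
  finally show ?thesis .
qed

lemma expectation_prod_bernoulli_family:
  fixes h :: "'a \<Rightarrow> bool \<Rightarrow> real"
  assumes "finite E" "0 \<le> p" "p \<le> 1" "\<And>e b. e \<in> E \<Longrightarrow> h e b \<ge> 0"
  shows "measure_pmf.expectation (bernoulli_family E p) (\<lambda>f. \<Prod>e\<in>E. h e (f e)) =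
    (\<Prod>e\<in>E. p * h e True + (1 - p) * h e False)"
  using assms by (subst expectation_prod_Pi_pmf) (auto intro: integrable_measure_pmf_finite simp: mult.commute)

text \<open>For \<open>a = exp s\<close> this is the moment generating function of a binomial count;
  positive and negative \<open>s\<close> yield the two tails.\<close>

lemma expectation_power_count:
  assumes "finite E" "S \<subseteq> E" "0 \<le> p" "p \<le> 1" "(a::real) \<ge> 0"
  shows "measure_pmf.expectation (bernoulli_family E p) (\<lambda>f. a ^ card {e \<in> S. f e}) =
    (1 + p * (a - 1)) ^ card S"
proof -
  have fin: "finite S" using assms finite_subset by blast
  define h where "h e b = (if e \<in> S \<and> b then a else 1)" for e b
  have "(\<Prod>e\<in>E. h e (f e)) = a ^ card {e \<in> S. f e}" for f
  proof -
    have "(\<Prod>e\<in>E. h e (f e)) = (\<Prod>e\<in>{e \<in> S. f e}. a)"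
      unfolding h_def using assms by (intro prod.mono_neutral_cong_right) auto
    then show ?thesis by simp
  qed
  then have "measure_pmf.expectation (bernoulli_family E p) (\<lambda>f. a ^ card {e \<in> S. f e}) =
    (\<Prod>e\<in>E. p * h e True + (1 - p) * h e False)"
    using expectation_prod_bernoulli_family[of E p h] assms by (simp add: h_def)
  also have "\<dots> = (\<Prod>e\<in>S. 1 + p * (a - 1))"
    unfolding h_def using assms by (intro prod.mono_neutral_cong_right) (auto simp: algebra_simps)
  finally show ?thesis by simp
qed

lemma power_one_plus_le_exp:
  fixes x :: real
  assumes "x \<ge> -1"
  shows "(1 + x) ^ n \<le> exp (n * x)"
  using assms power_mono[of "1 + x" "exp x" n] by (simp add: exp_of_nat_mult)

text \<open>The product of the right-hand side with the quadratic Taylor minorant of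
  \<open>exp d\<close> is \<open>1 + d ^ 4 / 4\<close>. There is no upper limit on \<open>d\<close>,
  hence none in the lower tail either.\<close>

lemma exp_minus_le:
  assumes "0 \<le> (d::real)"
  shows "exp (- d) \<le> 1 - d + d\<^sup>2 / 2"
proof -
  have "(1 - d + d\<^sup>2 / 2) * (1 + d + d\<^sup>2 / 2) = 1 + (d\<^sup>2)\<^sup>2 / 4"
    by (simp add: algebra_simps power2_eq_square)
  then have "1 \<le> (1 - d + d\<^sup>2 / 2) * (1 + d + d\<^sup>2 / 2)" by simp
  also have "\<dots> \<le> (1 - d + d\<^sup>2 / 2) * exp d"
  proof (rule mult_left_mono)
    show "1 + d + d\<^sup>2 / 2 \<le> exp d" using assms by (rule exp_lower_Taylor_quadratic)
    have "0 \<le> (1 - d)\<^sup>2 + 1" by simp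
    then show "0 \<le> 1 - d + d\<^sup>2 / 2" by (simp add: power2_eq_square algebra_simps)
  qed
  finally show ?thesis by (simp add: exp_minus field_simps)
qed

text \<open>Chernoff's argument with tilt \<open>- d\<close>. Any non-negative lower bound on the
  mean may serve as \<open>\<mu>\<close>, since often only a lower bound on the size of
  \<open>S\<close> is at hand.\<close>

lemma bernoulli_family_lower_tail:
  fixes p d \<mu> :: real
  assumes E: "finite E" "S \<subseteq> E" and p: "0 \<le> p" "p \<le> 1" and d: "0 \<le> d"
    and \<mu>: "\<mu> \<le> p * card S" "0 \<le> \<mu>"
  shows "measure_pmf.prob (bernoulli_family E p) {f. real (card {e \<in> S. f e}) \<le> (1 - d) * \<mu>}
    \<le> exp (- (d\<^sup>2 * \<mu> / 2))" (is "?P \<le> _")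
proof -
  let ?c = "exp (d * (1 - d) * \<mu>)"
  have "?P \<le> measure_pmf.expectation (bernoulli_family E p) (\<lambda>f. ?c * exp (- d) ^ card {e \<in> S. f e})"
  proof (rule prob_le_expectation)
    fix f assume "f \<in> {f. real (card {e \<in> S. f e}) \<le> (1 - d) * \<mu>}"
    then have "d * card {e \<in> S. f e} \<le> d * ((1 - d) * \<mu>)" using d by (intro mult_left_mono) auto
    then have "0 \<le> d * (1 - d) * \<mu> + card {e \<in> S. f e} * (- d)" by (simp add: algebra_simps)
    then show "1 \<le> ?c * exp (- d) ^ card {e \<in> S. f e}"
      by (simp add: exp_of_nat_mult[symmetric] exp_add[symmetric])
  qed (simp_all add: finite_set_bernoulli_family E)
  also have "\<dots> = ?c * (1 + p * (exp (- d) - 1)) ^ card S"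
    using E p by (simp add: expectation_power_count)
  also have "\<dots> \<le> ?c * exp (card S * (p * (exp (- d) - 1)))"
  proof (intro mult_left_mono power_one_plus_le_exp)
    have "p * (1 - exp (- d)) \<le> 1 * 1" using p d by (intro mult_mono) auto
    then show "-1 \<le> p * (exp (- d) - 1)" by (simp add: algebra_simps)
  qed simp
  also have "\<dots> = exp (d * (1 - d) * \<mu> + (p * card S) * (exp (- d) - 1))"
    by (simp add: exp_add[symmetric] algebra_simps)
  also have "\<dots> \<le> exp (- (d\<^sup>2 * \<mu> / 2))"
  proof -
    have "(p * card S) * (exp (- d) - 1) \<le> \<mu> * (exp (- d) - 1)"
      using \<mu>(1) d by (intro mult_right_mono_neg) auto
    also have "\<dots> \<le> \<mu> * (- d + d\<^sup>2 / 2)"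
      using exp_minus_le[OF d] \<mu>(2) by (intro mult_left_mono) auto
    finally show ?thesis by (simp add: algebra_simps power2_eq_square)
  qed
  finally show ?thesis .
qed

lemma bernoulli_family_upper_tail:
  fixes p d \<mu> :: real
  assumes E: "finite E" "S \<subseteq> E" and p: "0 \<le> p" "p \<le> 1" and d: "0 \<le> d" "d \<le> 1"
    and \<mu>: "p * card S \<le> \<mu>"
  shows "measure_pmf.prob (bernoulli_family E p) {f. real (card {e \<in> S. f e}) \<ge> (1 + d) * \<mu>}
    \<le> exp (- (d\<^sup>2 * \<mu> / 4))" (is "?P \<le> _")
proof -
  \<comment> \<open>With \<open>exp s \<le> 1 + s + s * s\<close> the exponent is at most
    \<open>(s * s - s * d) * \<mu>\<close>, which \<open>d / 2\<close> minimises. That estimate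
    holds for \<open>s\<close> between 0 and 1.\<close>
  define s where "s = d / 2"
  have s: "0 \<le> s" "s \<le> 1" using d by (auto simp: s_def)
  have \<mu>0: "0 \<le> \<mu>" using p(1) \<mu> by (meson mult_nonneg_nonneg of_nat_0_le_iff order_trans)
  let ?c = "exp (- (s * (1 + d) * \<mu>))"
  have "?P \<le> measure_pmf.expectation (bernoulli_family E p) (\<lambda>f. ?c * exp s ^ card {e \<in> S. f e})"
  proof (rule prob_le_expectation)
    fix f assume "f \<in> {f. real (card {e \<in> S. f e}) \<ge> (1 + d) * \<mu>}"
    then have "s * ((1 + d) * \<mu>) \<le> s * card {e \<in> S. f e}" using s by (intro mult_left_mono) auto
    then have "0 \<le> - (s * (1 + d) * \<mu>) + card {e \<in> S. f e} * s" by (simp add: algebra_simps)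
    then show "1 \<le> ?c * exp s ^ card {e \<in> S. f e}"
      by (simp add: exp_of_nat_mult[symmetric] exp_add[symmetric])
  qed (simp_all add: finite_set_bernoulli_family E)
  also have "\<dots> = ?c * (1 + p * (exp s - 1)) ^ card S"
    using E p by (simp add: expectation_power_count)
  also have "\<dots> \<le> ?c * exp (card S * (p * (exp s - 1)))"
  proof (intro mult_left_mono power_one_plus_le_exp)
    have "0 \<le> p * (exp s - 1)" using p s by (intro mult_nonneg_nonneg) auto
    then show "-1 \<le> p * (exp s - 1)" by simp
  qed simp
  also have "\<dots> = exp (- (s * (1 + d) * \<mu>) + (p * card S) * (exp s - 1))"
    by (simp add: exp_add[symmetric] algebra_simps)
  also have "\<dots> \<le> exp (- (d\<^sup>2 * \<mu> / 4))"
  proof -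
    have "(p * card S) * (exp s - 1) \<le> \<mu> * (exp s - 1)"
      using \<mu> s by (intro mult_right_mono) auto
    also have "\<dots> \<le> \<mu> * (s + s\<^sup>2)"
      using exp_bound[OF s] \<mu>0 by (intro mult_left_mono) auto
    finally show ?thesis by (simp add: algebra_simps power2_eq_square s_def add_divide_distrib)
  qed
  finally show ?thesis .
qed

text \<open>The set \<open>T B\<close> tested may depend on which members \<open>B\<close> of \<open>A\<close> occur, because \<open>A\<close> and \<open>T B\<close>
  are disjoint: condition on \<open>B\<close>.\<close>
lemma bernoulli_family_adaptive_upper_tail:
  fixes p a :: real
  assumes E: "finite E" "A \<subseteq> E" and p: "0 \<le> p" "p \<le> 1"
    and T: "\<And>B. B \<in> \<B> \<Longrightarrow> T B \<subseteq> E - A" "\<And>B. B \<in> \<B> \<Longrightarrow> card (T B) \<le> N"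
  shows "measure_pmf.prob (bernoulli_family E p)
      {f. {e \<in> A. f e} \<in> \<B> \<and> real (card {e \<in> T {e \<in> A. f e}. f e}) \<ge> a} \<le> exp (2 * p * N - a)"
    (is "?P \<le> _")
proof -
  let ?D = "bernoulli_family E p"
  have finA: "finite A" using E finite_subset by blast
  \<comment> \<open>The product of \<open>h B e (f e)\<close> over \<open>E\<close> is the indicator
    that \<open>f\<close> selects exactly \<open>B\<close> from \<open>A\<close>, times
    \<open>exp\<close> of the number of elements selected from \<open>T B\<close>. Its expectation
    is a product because each factor depends on one coordinate.\<close>
  define h where "h B e b = (if e \<in> A then (if b \<longleftrightarrow> e \<in> B then 1 else 0)
    else if e \<in> T B \<and> b then exp 1 else (1::real))" for B e b
  define g where "g f = (\<Sum>B\<in>{B \<in> \<B>. B \<subseteq> A}. exp (- a) * (\<Prod>e\<in>E. h B e (f e)))" for f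
  have finB: "finite {B \<in> \<B>. B \<subseteq> A}" by (rule finite_subset[of _ "Pow A"]) (use finA in auto)
  have h0: "h B e b \<ge> 0" for B e b by (simp add: h_def)
  have "?P \<le> measure_pmf.expectation ?D g"
  proof (rule prob_le_expectation)
    show "g f \<ge> 0" for f unfolding g_def using h0 by (intro sum_nonneg mult_nonneg_nonneg prod_nonneg) auto
    fix f assume f: "f \<in> {f. {e \<in> A. f e} \<in> \<B> \<and> real (card {e \<in> T {e \<in> A. f e}. f e}) \<ge> a}"
    define B where "B = {e \<in> A. f e}"
    have B: "B \<in> \<B>" "B \<subseteq> A" "a \<le> card {e \<in> T B. f e}" using f by (auto simp: B_def)
    have "(\<Prod>e\<in>E. h B e (f e)) = (\<Prod>e\<in>{e \<in> T B. f e}. exp 1)"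
      using T(1)[OF B(1)] E unfolding h_def B_def
      by (intro prod.mono_neutral_cong_right) auto
    also have "\<dots> = exp (card {e \<in> T B. f e})" by (simp add: exp_of_nat_mult[symmetric])
    finally have "1 \<le> exp (- a) * (\<Prod>e\<in>E. h B e (f e))"
      using B(3) by (simp add: exp_add[symmetric])
    also have "\<dots> \<le> g f"
      unfolding g_def using finB B h0
      by (intro member_le_sum mult_nonneg_nonneg prod_nonneg) auto
    finally show "1 \<le> g f" .
  qed (simp add: finite_set_bernoulli_family E)
  also have "\<dots> = (\<Sum>B\<in>{B \<in> \<B>. B \<subseteq> A}. exp (- a) * (\<Prod>e\<in>E. p * h B e True + (1 - p) * h B e False))"
  proof -
    have "measure_pmf.expectation ?D (\<lambda>f. \<Prod>e\<in>E. h B e (f e)) =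
        (\<Prod>e\<in>E. p * h B e True + (1 - p) * h B e False)" for B
      using E p h0 by (intro expectation_prod_bernoulli_family) auto
    then show ?thesis unfolding g_def
      by (subst Bochner_Integration.integral_sum)
         (auto intro!: integrable_measure_pmf_finite finite_set_bernoulli_family E)
  qed
  also have "\<dots> \<le> (\<Sum>B\<in>{B \<in> \<B>. B \<subseteq> A}. exp (2 * p * N - a) * ((\<Prod>e\<in>B. p) * (\<Prod>e\<in>A - B. 1 - p)))"
  proof (rule sum_mono)
    fix B assume B: "B \<in> {B \<in> \<B>. B \<subseteq> A}"
    let ?k = "\<lambda>e. p * h B e True + (1 - p) * h B e False"
    have "(\<Prod>e\<in>E. ?k e) = (\<Prod>e\<in>A. ?k e) * (\<Prod>e\<in>E - A. ?k e)"
      using prod.subset_diff[OF E(2,1), of ?k] by (simp add: mult.commute)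
    also have "(\<Prod>e\<in>A. ?k e) = (\<Prod>e\<in>B. ?k e) * (\<Prod>e\<in>A - B. ?k e)"
      using prod.subset_diff[of B A ?k] B finA by (simp add: mult.commute)
    also have "(\<Prod>e\<in>B. ?k e) = (\<Prod>e\<in>B. p)"
      using B by (intro prod.cong) (auto simp: h_def)
    also have "(\<Prod>e\<in>A - B. ?k e) = (\<Prod>e\<in>A - B. 1 - p)"
      by (intro prod.cong) (auto simp: h_def)
    also have "(\<Prod>e\<in>E - A. ?k e) = (\<Prod>e\<in>T B. 1 + p * (exp 1 - 1))"
      using T(1)[of B] B E unfolding h_def
      by (intro prod.mono_neutral_cong_right) (auto simp: algebra_simps)
    also have "\<dots> \<le> exp (2 * p * N)"
    proof -
      have "(\<Prod>e\<in>T B. 1 + p * (exp 1 - 1)) \<le> exp (card (T B) * (p * (exp 1 - 1)))"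
        using power_one_plus_le_exp[of "p * (exp 1 - 1)" "card (T B)"] p
        by (simp add: mult_nonneg_nonneg order_trans[of "-1" 0])
      \<comment> \<open>The factor 2 comes from \<open>exp 1 - 1 \<le> 2\<close>.\<close>
      also have "card (T B) * (p * (exp 1 - 1)) \<le> N * (p * 2)"
        using T(2)[of B] B p exp_le by (intro mult_mono) auto
      finally show ?thesis by (simp add: mult_ac)
    qed
    finally have "(\<Prod>e\<in>E. ?k e) \<le> (\<Prod>e\<in>B. p) * (\<Prod>e\<in>A - B. 1 - p) * exp (2 * p * N)"
      using p by (simp add: mult_left_mono prod_nonneg)
    then have "exp (- a) * (\<Prod>e\<in>E. ?k e) \<le>
        exp (- a) * ((\<Prod>e\<in>B. p) * (\<Prod>e\<in>A - B. 1 - p) * exp (2 * p * N))"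
      by (intro mult_left_mono) auto
    also have "\<dots> = exp (2 * p * N - a) * ((\<Prod>e\<in>B. p) * (\<Prod>e\<in>A - B. 1 - p))"
      by (simp add: exp_diff exp_minus field_simps)
    finally show "exp (- a) * (\<Prod>e\<in>E. ?k e) \<le> \<dots>" .
  qed
  also have "\<dots> = exp (2 * p * N - a) * (\<Sum>B\<in>{B \<in> \<B>. B \<subseteq> A}. (\<Prod>e\<in>B. p) * (\<Prod>e\<in>A - B. 1 - p))"
    by (rule sum_distrib_left[symmetric])
  also have "\<dots> \<le> exp (2 * p * N - a) * (\<Sum>B\<in>Pow A. (\<Prod>e\<in>B. p) * (\<Prod>e\<in>A - B. 1 - p))"
    using finA p by (intro mult_left_mono sum_mono2) auto
  also have "(\<Sum>B\<in>Pow A. (\<Prod>e\<in>B. p) * (\<Prod>e\<in>A - B. 1 - p)) = (\<Prod>e\<in>A. p + (1 - p))"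
    using finA by (rule prod_add[symmetric])
  finally show ?thesis by simp
qed

section \<open>Blow-ups inside the random graph\<close>

definition sample_graph :: "nat \<Rightarrow> (nat set \<Rightarrow> bool) \<Rightarrow> nat ugraph" where
  "sample_graph n f = UGraph {1..n} {e \<in> vertex_pairs {1..n}. f e}"

lemma prob_gnp:
  "measure_pmf.prob (gnp n p) {G. P G} =
    measure_pmf.prob (bernoulli_family (vertex_pairs {1..n}) p) {f. P (sample_graph n f)}"
  by (simp add: gnp_def sample_graph_def vimage_def)

lemma finite_vertex_pairs [simp]: "finite V \<Longrightarrow> finite (vertex_pairs V)"
  unfolding vertex_pairs_def by (rule finite_subset[of _ "Pow V"]) auto

lemma doubleton_in_vertex_pairs: "{x, y} \<in> vertex_pairs V \<longleftrightarrow> x \<in> V \<and> y \<in> V \<and> x \<noteq> y"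
  by (auto simp: vertex_pairs_def card_insert_if)

lemma vertex_pairsE:
  assumes "e \<in> vertex_pairs V"
  obtains x y where "e = {x, y}" "x \<in> V" "y \<in> V" "x \<noteq> y"
  using assms unfolding vertex_pairs_def by (auto simp: card_2_iff)

lemma le_min_degree:
  fixes x :: real
  assumes "finite (verts G)" "verts G \<noteq> {}" "\<And>v. v \<in> verts G \<Longrightarrow> x \<le> real (vertex_degree G v)"
  shows "x \<le> real (min_degree G)"
proof -
  have "min_degree G \<in> vertex_degree G ` verts G"
    unfolding min_degree_def using assms by (intro Min_in) auto
  then show ?thesis using assms(3) by auto
qed

lemma le_del_partite:
  fixes x :: real
  assumes "finite (verts G)" "q \<ge> 1"
    "\<And>\<phi>. \<phi> \<in> verts G \<rightarrow>\<^sub>E {1..q} \<Longrightarrow> x \<le> real (card (mono_edges G \<phi>))"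
  shows "x \<le> real (del_partite q G)"
proof -
  have "verts G \<rightarrow>\<^sub>E {1..q} \<noteq> {}" using assms(2) by (auto simp: PiE_eq_empty_iff)
  then have "del_partite q G \<in> (\<lambda>\<phi>. card (mono_edges G \<phi>)) ` (verts G \<rightarrow>\<^sub>E {1..q})"
    unfolding del_partite_def using assms by (intro Min_in) (auto intro!: finite_PiE)
  then show ?thesis using assms(3) by auto
qed

lemma del_partite_le:
  assumes "finite (verts G)" "\<phi> \<in> verts G \<rightarrow>\<^sub>E {1..q}"
  shows "del_partite q G \<le> card (mono_edges G \<phi>)"
  unfolding del_partite_def using assms by (intro Min_le) (auto intro!: finite_PiE)

lemma prob_Un_bounds:
  fixes b c :: real
  assumes "finite I" "finite J" "A \<subseteq> (\<Union>i\<in>I. B i) \<union> (\<Union>j\<in>J. C j)"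
    "\<And>i. i \<in> I \<Longrightarrow> measure_pmf.prob D (B i) \<le> b" "\<And>j. j \<in> J \<Longrightarrow> measure_pmf.prob D (C j) \<le> c"
  shows "measure_pmf.prob D A \<le> card I * b + card J * c"
proof -
  have "measure_pmf.prob D A \<le> measure_pmf.prob D ((\<Union>i\<in>I. B i) \<union> (\<Union>j\<in>J. C j))"
    using assms by (intro measure_pmf.finite_measure_mono) auto
  also have "\<dots> \<le> measure_pmf.prob D (\<Union>i\<in>I. B i) + measure_pmf.prob D (\<Union>j\<in>J. C j)"
    by (intro measure_Un_le) auto
  also have "measure_pmf.prob D (\<Union>i\<in>I. B i) \<le> (\<Sum>i\<in>I. measure_pmf.prob D (B i))"
    using assms by (intro measure_pmf.finite_measure_subadditive_finite) auto
  also have "\<dots> \<le> card I * b" using assms sum_bounded_above[of I "\<lambda>i. measure_pmf.prob D (B i)" b] by simp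
  also have "measure_pmf.prob D (\<Union>j\<in>J. C j) \<le> (\<Sum>j\<in>J. measure_pmf.prob D (C j))"
    using assms by (intro measure_pmf.finite_measure_subadditive_finite) auto
  also have "\<dots> \<le> card J * c" using assms sum_bounded_above[of J "\<lambda>i. measure_pmf.prob D (C i)" c] by simp
  finally show ?thesis by simp
qed

lemma card_residue_class_ge:
  fixes M n j :: nat
  assumes "j < M"
  shows "n div M \<le> card {u \<in> {1..n}. (u - 1) mod M = j}"
proof -
  have "inj_on (\<lambda>t. t * M + j + 1) {..<n div M}" using assms by (auto simp: inj_on_def)
  moreover have "(\<lambda>t. t * M + j + 1) ` {..<n div M} \<subseteq> {u \<in> {1..n}. (u - 1) mod M = j}"
  proof
    fix u assume "u \<in> (\<lambda>t. t * M + j + 1) ` {..<n div M}"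
    then obtain t where t: "t < n div M" "u = t * M + j + 1" by auto
    have "(t + 1) * M \<le> n div M * M" using t by (intro mult_right_mono) auto
    also have "\<dots> \<le> n" by simp
    finally show "u \<in> {u \<in> {1..n}. (u - 1) mod M = j}" using t assms by auto
  qed
  ultimately have "card {..<n div M} \<le> card {u \<in> {1..n}. (u - 1) mod M = j}"
    by (intro card_inj_on_le) auto
  then show ?thesis by simp
qed

text \<open>Vertex \<open>u\<close> belongs to class \<open>(u - 1) mod M\<close>, since vertices
  count from 1 and classes from 0. Residues keep the classes balanced.\<close>

definition blow_up_pairs :: "nat \<Rightarrow> (nat \<Rightarrow> nat \<Rightarrow> bool) \<Rightarrow> nat \<Rightarrow> nat set set" where
  "blow_up_pairs M R n =
    {e \<in> vertex_pairs {1..n}. \<exists>x y. e = {x, y} \<and> R ((x - 1) mod M) ((y - 1) mod M)}"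

lemma ex_popular_colour:
  assumes "finite A" "\<phi> ` A \<subseteq> {1..q::nat}" "q \<ge> 1"
  shows "\<exists>i\<in>{1..q}. card A \<le> q * card {u \<in> A. \<phi> u = i}"
proof (rule ccontr)
  assume "\<not> ?thesis"
  then have *: "q * card {u \<in> A. \<phi> u = i} < card A" if "i \<in> {1..q}" for i
    using that by (auto simp: not_le)
  have "card A = (\<Sum>i\<in>{1..q}. card {u \<in> A. \<phi> u = i})"
    using assms by (subst card_UN_disjoint[symmetric]) (auto intro!: arg_cong[where f = card])
  then have "q * card A = (\<Sum>i\<in>{1..q}. q * card {u \<in> A. \<phi> u = i})" by (simp add: sum_distrib_left)
  also have "\<dots> < (\<Sum>i\<in>{1..q}. card A)" using * assms by (intro sum_strict_mono) auto
  finally show False by simp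
qed

lemma card_pairs_between:
  assumes "X \<subseteq> V" "Y \<subseteq> V" "X \<inter> Y = {}" "finite V"
    "\<And>x y. x \<in> X \<Longrightarrow> y \<in> Y \<Longrightarrow> {x, y} \<in> S" "S \<subseteq> vertex_pairs V"
  shows "card X * card Y \<le> card S"
proof -
  have "inj_on (\<lambda>(x, y). {x, y}) (X \<times> Y)"
    using assms(3) by (auto simp: inj_on_def doubleton_eq_iff)
  moreover have "(\<lambda>(x, y). {x, y}) ` (X \<times> Y) \<subseteq> S" using assms(5) by auto
  moreover have "finite S" using assms(4,6) finite_vertex_pairs finite_subset by blast
  ultimately have "card (X \<times> Y) \<le> card S" by (intro card_inj_on_le) auto
  then show ?thesis by (simp add: card_cartesian_product)
qed

context
  fixes q M :: nat and R :: "nat \<Rightarrow> nat \<Rightarrow> bool" and \<theta> :: real and n :: nat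
  assumes obs: "dense_obstruction q \<theta> M R" and q: "q \<ge> 1" and \<theta>: "\<theta> \<ge> 0" and nM: "2 * M \<le> n"
begin

private lemma M1: "M \<ge> 1" using obs by (simp add: dense_obstruction_def)

private lemma symR: "R x y \<Longrightarrow> R y x" using obs unfolding dense_obstruction_def by blast

private lemma irreflR: "\<not> R x x" using obs unfolding dense_obstruction_def by blast

private lemma triR: "R x y \<Longrightarrow> R y z \<Longrightarrow> \<not> R x z"
  using obs unfolding dense_obstruction_def by blast

private lemma colR: "\<forall>x<M. c x < q \<Longrightarrow> \<exists>x<M. \<exists>y<M. R x y \<and> c x = c y" for c :: "nat \<Rightarrow> nat"
  using obs unfolding dense_obstruction_def by blast

lemma doubleton_in_blow_up_pairs:
  "{x, y} \<in> blow_up_pairs M R n \<longleftrightarrow> x \<in> {1..n} \<and> y \<in> {1..n} \<and> R ((x - 1) mod M) ((y - 1) mod M)"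
proof -
  have "x \<noteq> y" if "R ((x - 1) mod M) ((y - 1) mod M)" for x y using that irreflR by auto
  then show ?thesis
    using symR unfolding blow_up_pairs_def mem_Collect_eq doubleton_in_vertex_pairs doubleton_eq_iff
    by blast
qed

private lemma quotient_bounds: "real n - M \<le> M * (n div M)" "real n / (2 * M) \<le> n div M"
proof -
  have "n = M * (n div M) + n mod M" by simp
  moreover have "n mod M < M" using M1 by simp
  ultimately have "n \<le> M * (n div M) + M" by linarith
  then show *: "real n - M \<le> M * (n div M)" by (metis diff_le_eq of_nat_add of_nat_mono of_nat_mult)
  have "real n / 2 \<le> real n - M" using nM by linarith
  with * have "real n / 2 \<le> M * (n div M)" by linarith
  then show "real n / (2 * M) \<le> n div M" using M1 by (simp add: field_simps)
qed

lemma card_blow_up_star_ge: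
  assumes v: "v \<in> {1..n}"
  shows "\<theta> * (real n - M) \<le> card {e \<in> blow_up_pairs M R n. v \<in> e}"
proof -
  let ?cl = "\<lambda>u. (u - 1) mod M"
  let ?J = "{j. j < M \<and> R (?cl v) j}"
  have "\<theta> * (real n - M) \<le> \<theta> * (M * (n div M))"
    using quotient_bounds(1) \<theta> by (intro mult_left_mono) auto
  also have "\<dots> = (\<theta> * M) * (n div M)" by simp
  also have "\<dots> \<le> card ?J * (n div M)"
  proof -
    have "?cl v < M" using M1 by simp
    then have "\<theta> * M \<le> card ?J" using obs unfolding dense_obstruction_def by blast
    then show ?thesis by (simp add: mult_right_mono)
  qed
  also have "card ?J * (n div M) \<le> (\<Sum>j\<in>?J. card {u \<in> {1..n}. ?cl u = j})"
    using card_residue_class_ge[of _ M n]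
      sum_mono[of ?J "\<lambda>_. n div M" "\<lambda>j. card {u \<in> {1..n}. ?cl u = j}"] by simp
  also have "\<dots> = card (\<Union>j\<in>?J. {u \<in> {1..n}. ?cl u = j})"
    by (subst card_UN_disjoint) auto
  also have "(\<Union>j\<in>?J. {u \<in> {1..n}. ?cl u = j}) = {u \<in> {1..n}. R (?cl v) (?cl u)}"
    using M1 by auto
  also have "card \<dots> \<le> card {e \<in> blow_up_pairs M R n. v \<in> e}"
  proof (rule card_inj_on_le)
    show "inj_on (\<lambda>u. {v, u}) {u \<in> {1..n}. R (?cl v) (?cl u)}"
      by (auto simp: inj_on_def doubleton_eq_iff)
    show "(\<lambda>u. {v, u}) ` {u \<in> {1..n}. R (?cl v) (?cl u)} \<subseteq> {e \<in> blow_up_pairs M R n. v \<in> e}"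
      using v doubleton_in_blow_up_pairs by auto
    show "finite {e \<in> blow_up_pairs M R n. v \<in> e}" by (simp add: blow_up_pairs_def)
  qed
  finally show ?thesis by simp
qed

text \<open>The most frequent colour of each class colours the obstruction, so two adjacent classes
  share it. By \<open>2 * M \<le> n\<close> a class has at least \<open>n / (2 * M)\<close>
  vertices, of which this colour takes a \<open>q\<close>-th part; all pairs between the two parts
  count.\<close>

lemma card_blow_up_mono_ge:
  assumes \<phi>: "\<phi> \<in> {1..n} \<rightarrow> {1..q}"
  shows "(real n / (2 * M * q))\<^sup>2 \<le>
    card {e \<in> blow_up_pairs M R n. \<exists>x y. e = {x, y} \<and> \<phi> x = \<phi> y}" (is "_ \<le> real (card ?S)")
proof -
  let ?A = "\<lambda>j. {u \<in> {1..n}. (u - 1) mod M = j}"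
  have "\<exists>i\<in>{1..q}. card (?A j) \<le> q * card {u \<in> ?A j. \<phi> u = i}" for j
    using \<phi> q by (intro ex_popular_colour) auto
  then have "\<exists>\<psi>. \<forall>j. \<psi> j \<in> {1..q} \<and> card (?A j) \<le> q * card {u \<in> ?A j. \<phi> u = \<psi> j}"
    by (intro choice) blast
  then obtain \<psi> where \<psi>: "\<And>j. \<psi> j \<in> {1..q}"
    "\<And>j. card (?A j) \<le> q * card {u \<in> ?A j. \<phi> u = \<psi> j}" by blast
  \<comment> \<open>Colours run from 1 here and from 0 in \<open>dense_obstruction\<close>, hence
    the shift.\<close>
  have "\<psi> x - 1 < q" for x using \<psi>(1)[of x] by auto
  then obtain i j where ij: "i < M" "j < M" "R i j" "\<psi> i - 1 = \<psi> j - 1"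
    using colR[of "\<lambda>x. \<psi> x - 1"] by auto
  have eq: "\<psi> i = \<psi> j" using ij(4) \<psi>(1)[of i] \<psi>(1)[of j] by auto
  let ?X = "\<lambda>j. {u \<in> ?A j. \<phi> u = \<psi> j}"
  have big: "real n / (2 * M * q) \<le> card (?X j)" if "j < M" for j
  proof -
    have "real n / (2 * M) \<le> n div M" by (rule quotient_bounds)
    also have "\<dots> \<le> q * card (?X j)" using card_residue_class_ge[OF that, of n] \<psi>(2)[of j] by linarith
    finally have "real n / (2 * M) \<le> real (card (?X j)) * q" by (simp add: mult.commute)
    then have "real n / (2 * M) / q \<le> real (card (?X j))"
      using q by (subst pos_divide_le_eq) auto
    then show ?thesis by (simp add: divide_divide_eq_left)
  qed
  have "(real n / (2 * M * q))\<^sup>2 \<le> card (?X i) * real (card (?X j))"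
    unfolding power2_eq_square using big ij by (intro mult_mono) auto
  also have "\<dots> = real (card (?X i) * card (?X j))" by simp
  also have "card (?X i) * card (?X j) \<le> card ?S"
  proof (rule card_pairs_between[where V = "{1..n}"])
    show "?X i \<inter> ?X j = {}" using ij irreflR by auto
    show "{x, y} \<in> ?S" if "x \<in> ?X i" "y \<in> ?X j" for x y
    proof -
      have "{x, y} \<in> blow_up_pairs M R n" using that ij by (auto simp: doubleton_in_blow_up_pairs)
      moreover have "\<phi> x = \<phi> y" using that eq by auto
      ultimately show ?thesis by blast
    qed
  qed (auto simp: blow_up_pairs_def)
  finally show ?thesis by simp
qed

text \<open>For each \<open>\<phi>\<close> the monochromatic pairs of the blow-up form a fixed set,
  so every bad event concerns one binomial count. Half of the expected count is conceded, and
  deviation \<open>1/2\<close> gives the exponent its factor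
  \<open>(1/2) ^ 2 / 2 = 1/8\<close>.\<close>

lemma prob_no_blow_up_subgraph:
  fixes p \<delta> :: real
  assumes p: "0 < p" "p \<le> 1" and \<delta>: "0 \<le> \<delta>"
  shows "measure_pmf.prob (gnp n p) {G. \<not> (\<exists>H. spanning_subgraph H G \<and> triangle_free H \<and>
      (1 - \<delta>) * (p * (\<theta> * (real n - M))) \<le> real (min_degree H) \<and>
      p * (real n / (2 * M * q))\<^sup>2 / 2 \<le> real (del_partite q H))}
    \<le> real n * exp (- (\<delta>\<^sup>2 * (p * (\<theta> * (real n - M))) / 2)) +
      real q ^ n * exp (- (p * (real n / (2 * M * q))\<^sup>2 / 8))"
proof -
  let ?E = "vertex_pairs {1..n}" and ?B = "blow_up_pairs M R n"
  let ?\<mu> = "p * (\<theta> * (real n - M))" and ?\<nu> = "p * (real n / (2 * M * q))\<^sup>2"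
  let ?S = "\<lambda>\<phi>. {e \<in> ?B. \<exists>x y. e = {x, y} \<and> \<phi> x = \<phi> y}"
  let ?bad = "\<lambda>v. {f. real (card {e \<in> {e \<in> ?B. v \<in> e}. f e}) \<le> (1 - \<delta>) * ?\<mu>}"
  let ?bad' = "\<lambda>\<phi>. {f. real (card {e \<in> ?S \<phi>. f e}) \<le> (1 - 1/2) * ?\<nu>}"
  let ?\<Phi> = "{1..n} \<rightarrow>\<^sub>E {1..q}"
  have BE: "?B \<subseteq> ?E" by (auto simp: blow_up_pairs_def)
  have n1: "n \<ge> 1" using nM M1 by simp
  have "{f. \<not> (\<exists>H. spanning_subgraph H (sample_graph n f) \<and> triangle_free H \<and>
      (1 - \<delta>) * ?\<mu> \<le> real (min_degree H) \<and> ?\<nu> / 2 \<le> real (del_partite q H))}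
    \<subseteq> (\<Union>v\<in>{1..n}. ?bad v) \<union> (\<Union>\<phi>\<in>?\<Phi>. ?bad' \<phi>)" (is "?L \<subseteq> ?R")
  proof
    fix f assume f: "f \<in> ?L"
    show "f \<in> ?R"
    proof (rule ccontr)
      assume no: "f \<notin> ?R"
      define H where "H = UGraph {1..n} {e \<in> ?B. f e}"
      have "spanning_subgraph H (sample_graph n f)"
        using BE by (auto simp: H_def spanning_subgraph_def simple_graph_def sample_graph_def)
      moreover have "triangle_free H"
        unfolding triangle_free_def
      proof clarify
        fix x y z assume "{x, y} \<in> edges H" "{y, z} \<in> edges H" "{x, z} \<in> edges H"
        then have "R ((x - 1) mod M) ((y - 1) mod M)" "R ((y - 1) mod M) ((z - 1) mod M)"
          "R ((x - 1) mod M) ((z - 1) mod M)"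
          unfolding H_def by (simp_all add: doubleton_in_blow_up_pairs)
        then show False using triR by blast
      qed
      moreover have "(1 - \<delta>) * ?\<mu> \<le> real (min_degree H)"
      proof (rule le_min_degree)
        fix v assume "v \<in> verts H"
        then have "f \<notin> ?bad v" using no by (auto simp: H_def)
        moreover have "{e \<in> {e \<in> ?B. v \<in> e}. f e} = {e \<in> edges H. v \<in> e}" by (auto simp: H_def)
        ultimately show "(1 - \<delta>) * ?\<mu> \<le> real (vertex_degree H v)"
          by (simp add: vertex_degree_def)
      qed (use n1 in \<open>auto simp: H_def\<close>)
      moreover have "?\<nu> / 2 \<le> real (del_partite q H)"
      proof (rule le_del_partite)
        fix \<phi> assume "\<phi> \<in> verts H \<rightarrow>\<^sub>E {1..q}"
        then have "f \<notin> ?bad' \<phi>" using no by (auto simp: H_def)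
        moreover have "{e \<in> ?S \<phi>. f e} = mono_edges H \<phi>" by (auto simp: H_def mono_edges_def)
        ultimately show "?\<nu> / 2 \<le> real (card (mono_edges H \<phi>))" by simp
      qed (use q in \<open>auto simp: H_def\<close>)
      ultimately show False using f by blast
    qed
  qed
  note sub = this
  have "measure_pmf.prob (bernoulli_family ?E p) ?L \<le>
    card {1..n} * exp (- (\<delta>\<^sup>2 * ?\<mu> / 2)) + card ?\<Phi> * exp (- (?\<nu> / 8))"
  proof (rule prob_Un_bounds[where B = ?bad and C = ?bad'])
    show "finite ?\<Phi>" by (intro finite_PiE) auto
    show "?L \<subseteq> ?R" by (fact sub)
    fix v assume v: "v \<in> {1..n}"
    have "0 \<le> \<theta> * (real n - M)" using \<theta> nM by simp
    then show "measure_pmf.prob (bernoulli_family ?E p) (?bad v) \<le> exp (- (\<delta>\<^sup>2 * ?\<mu> / 2))"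
      using BE p \<delta> card_blow_up_star_ge[OF v]
      by (intro bernoulli_family_lower_tail mult_left_mono) auto
  next
    fix \<phi> assume "\<phi> \<in> ?\<Phi>"
    then have "\<phi> \<in> {1..n} \<rightarrow> {1..q}" by auto
    then have "measure_pmf.prob (bernoulli_family ?E p) (?bad' \<phi>) \<le> exp (- ((1/2)\<^sup>2 * ?\<nu> / 2))"
      using BE p card_blow_up_mono_ge[of \<phi>]
      by (intro bernoulli_family_lower_tail mult_left_mono) auto
    then show "measure_pmf.prob (bernoulli_family ?E p) (?bad' \<phi>) \<le> exp (- (?\<nu> / 8))"
      by (simp add: power_divide mult.commute)
  qed auto
  moreover have "real (card ?\<Phi>) = real q ^ n" by (simp add: card_PiE)
  ultimately show ?thesis unfolding prob_gnp by simp
qed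

end

section \<open>Asymptotics\<close>

lemma aas_of_failure_bound:
  assumes "\<forall>\<^sub>F n in sequentially. measure_pmf.prob (M n) {x. \<not> P n x} \<le> g n" "g \<longlonglongrightarrow> 0"
  shows "asym_almost_surely M P"
  unfolding asym_almost_surely_def
proof (rule tendsto_sandwich)
  have "measure_pmf.prob (M n) {x. P n x} = 1 - measure_pmf.prob (M n) {x. \<not> P n x}" for n
    using measure_pmf.prob_compl[of "{x. \<not> P n x}" "M n"]
    by (simp add: Compl_eq_Diff_UNIV[symmetric] Collect_neg_eq[symmetric])
  then show "\<forall>\<^sub>F n in sequentially. 1 - g n \<le> measure_pmf.prob (M n) {x. P n x}"
    using assms(1) by (auto elim: eventually_mono)
  show "(\<lambda>n. 1 - g n) \<longlonglongrightarrow> 1" using tendsto_diff[OF tendsto_const assms(2), of 1] by simp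
qed auto

lemma eventually_ln_le:
  fixes K :: real and p :: "nat \<Rightarrow> real"
  assumes "filterlim (\<lambda>n. p n * real n / ln (real n)) at_top sequentially"
  shows "\<forall>\<^sub>F n in sequentially. K * ln (real n) \<le> p n * real n"
proof -
  have "\<forall>\<^sub>F n in sequentially. K \<le> p n * real n / ln (real n)"
    using assms by (simp add: filterlim_at_top)
  then show ?thesis using eventually_ge_at_top[of 2]
  proof eventually_elim
    case (elim n)
    then have "0 < ln (real n)" by simp
    with elim(1) show ?case by (simp add: pos_le_divide_eq)
  qed
qed

lemma eventually_const_le:
  fixes K :: real and p :: "nat \<Rightarrow> real"
  assumes "filterlim (\<lambda>n. p n * real n / ln (real n)) at_top sequentially"
  shows "\<forall>\<^sub>F n in sequentially. K \<le> p n * real n"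
  using eventually_ln_le[OF assms, of "max K 0"] eventually_ge_at_top[of 3]
proof eventually_elim
  case (elim n)
  have "exp 1 \<le> real n" using exp_le elim(2) by linarith
  then have "1 \<le> ln (real n)" using elim(2) by (simp add: ln_ge_iff)
  then have "max K 0 * 1 \<le> max K 0 * ln (real n)" by (intro mult_left_mono) auto
  then show ?case using elim(1) by linarith
qed

text \<open>The union over vertices is what requires growth beyond the logarithm:
  \<open>2 / C\<close> times \<open>ln n\<close> leaves \<open>1 / n\<close>, and \<open>C\<close>
  is small when the permitted error is.\<close>

lemma linear_union_bound_tendsto_0:
  fixes C :: real and p :: "nat \<Rightarrow> real"
  assumes p: "filterlim (\<lambda>n. p n * real n / ln (real n)) at_top sequentially" and C: "C > 0"
  shows "(\<lambda>n. real n * exp (- (C * (p n * real n)))) \<longlonglongrightarrow> 0"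
proof (rule tendsto_sandwich[where f = "\<lambda>_. 0"])
  show "\<forall>\<^sub>F n in sequentially. real n * exp (- (C * (p n * real n))) \<le> 1 / real n"
    using eventually_ln_le[OF p, of "2 / C"] eventually_ge_at_top[of 1]
  proof eventually_elim
    case (elim n)
    have "2 * ln (real n) \<le> C * (p n * real n)"
      using elim(1) C by (simp add: field_simps)
    then have "exp (- (C * (p n * real n))) \<le> exp (- (2 * ln (real n)))" by simp
    also have "\<dots> = 1 / (real n * real n)"
      using elim(2) by (simp add: exp_minus exp_double power2_eq_square field_simps)
    finally have "real n * exp (- (C * (p n * real n))) \<le> real n * (1 / (real n * real n))"
      by (intro mult_left_mono) auto
    then show ?case using elim(2) by simp
  qed
  show "(\<lambda>n. 1 / real n) \<longlonglongrightarrow> 0" by (rule lim_1_over_n)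
qed (auto intro: always_eventually)

text \<open>The exponent has an extra factor \<open>n\<close>, so it is enough that
  \<open>p n * n\<close> exceeds the constant \<open>(ln q + 1) / C\<close>; what remains is
  \<open>exp (- n)\<close>.\<close>

lemma exponential_union_bound_tendsto_0:
  fixes C :: real and p :: "nat \<Rightarrow> real"
  assumes p: "filterlim (\<lambda>n. p n * real n / ln (real n)) at_top sequentially" and C: "C > 0"
    and q: "q \<ge> (1::nat)"
  shows "(\<lambda>n. real q ^ n * exp (- (C * (p n * real n) * real n))) \<longlonglongrightarrow> 0"
proof (rule tendsto_sandwich[where f = "\<lambda>_. 0"])
  show "\<forall>\<^sub>F n in sequentially. real q ^ n * exp (- (C * (p n * real n) * real n)) \<le> exp (- 1) ^ n"
    using eventually_const_le[OF p, of "(ln q + 1) / C"]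
  proof eventually_elim
    case (elim n)
    have "ln q + 1 \<le> C * (p n * real n)" using elim C by (simp add: field_simps)
    then have "(ln q + 1) * n \<le> C * (p n * real n) * n" by (intro mult_right_mono) auto
    then have "exp (n * ln q + - (C * (p n * real n) * real n)) \<le> exp (real n * (- 1))"
      by (simp add: algebra_simps)
    moreover have "exp (n * ln q) = real q ^ n" using q by (subst exp_of_nat_mult) simp
    moreover have "exp (real n * (- 1)) = exp (- 1 :: real) ^ n" by (rule exp_of_nat_mult)
    ultimately show ?case by (simp only: exp_add)
  qed
  show "(\<lambda>n. exp (- 1 :: real) ^ n) \<longlonglongrightarrow> 0" by (rule LIMSEQ_realpow_zero) auto
qed (auto intro: always_eventually)

section \<open>Assertion (i) from a given obstruction\<close>

lemma aas_dense_far_from_partite: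
  fixes \<theta> \<eta> :: real and p :: "nat \<Rightarrow> real"
  assumes obs: "dense_obstruction q \<theta> M R" and q: "q \<ge> 1" and \<theta>: "0 < \<theta>" "\<theta> \<le> 1" and \<eta>: "\<eta> > 0"
    and p: "\<forall>n\<ge>1. 0 < p n \<and> p n \<le> 1"
      "filterlim (\<lambda>n. p n * real n / ln (real n)) at_top sequentially"
  shows "asym_almost_surely (\<lambda>n. gnp n (p n))
    (\<lambda>n G. \<exists>H. spanning_subgraph H G \<and> triangle_free H \<and>
      real (min_degree H) \<ge> (\<theta> - \<eta>) * p n * real n \<and>
      real (del_partite q H) \<ge> 1 / (8 * (real M * real q)\<^sup>2) * p n * (real n)\<^sup>2)"
    (is "asym_almost_surely _ ?P")
proof (rule aas_of_failure_bound)
  \<comment> \<open>One half of \<open>\<eta>\<close> pays for the deviation of the degrees, the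
    other for the rounding loss \<open>M\<close>, at most \<open>\<delta> * n\<close> for large
    \<open>n\<close>.\<close>
  define \<delta> where "\<delta> = \<eta> / 2"
  \<comment> \<open>\<open>C\<close> rests on \<open>n - M \<ge> n / 2\<close>. In \<open>C'\<close>
    the 32 is \<open>2 ^ 2 * 8\<close>, from the square of \<open>n / (2 * M * q)\<close> and the
    tail exponent.\<close>
  define C where "C = \<delta>\<^sup>2 * \<theta> / 4"
  define C' where "C' = 1 / (32 * (real M * real q)\<^sup>2)"
  have M: "M \<ge> 1" using obs by (simp add: dense_obstruction_def)
  have C: "C > 0" "C' > 0" using \<eta> \<theta> M q by (simp_all add: C_def C'_def \<delta>_def)
  show "(\<lambda>n. real n * exp (- (C * (p n * real n))) +
      real q ^ n * exp (- (C' * (p n * real n) * real n))) \<longlonglongrightarrow> 0"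
    using tendsto_add[OF linear_union_bound_tendsto_0[OF p(2) C(1)]
        exponential_union_bound_tendsto_0[OF p(2) C(2) q]] by simp
  show "\<forall>\<^sub>F n in sequentially. measure_pmf.prob (gnp n (p n)) {G. \<not> ?P n G} \<le>
      real n * exp (- (C * (p n * real n))) + real q ^ n * exp (- (C' * (p n * real n) * real n))"
    using eventually_ge_at_top[of "2 * M"] eventually_ge_at_top[of "nat \<lceil>M / \<delta>\<rceil>"]
  proof eventually_elim
    case (elim n)
    have n1: "n \<ge> 1" using elim(1) M by simp
    have pn: "0 < p n" "p n \<le> 1" using p(1) n1 by auto
    have \<delta>0: "0 < \<delta>" using \<eta> by (simp add: \<delta>_def)
    have "M / \<delta> \<le> n" using elim(2) by linarith
    then have Mn: "M \<le> \<delta> * n" using \<delta>0 by (simp add: field_simps)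
    let ?Q = "\<lambda>G H. spanning_subgraph H G \<and> triangle_free H \<and>
      (1 - \<delta>) * (p n * (\<theta> * (real n - M))) \<le> real (min_degree H) \<and>
      p n * (real n / (2 * M * q))\<^sup>2 / 2 \<le> real (del_partite q H)"
    have deg: "(\<theta> - \<eta>) * p n * real n \<le> (1 - \<delta>) * (p n * (\<theta> * (real n - M)))"
    proof -
      have "\<delta> * \<theta> * n \<le> \<delta> * 1 * n" using \<theta> \<delta>0 by (intro mult_right_mono mult_left_mono) auto
      moreover have "(1 - \<delta>) * \<theta> * M \<le> 1 * real M"
      proof (rule mult_right_mono)
        have "(1 - \<delta>) * \<theta> \<le> 1 * \<theta>" using \<delta>0 \<theta> by (intro mult_right_mono) auto
        then show "(1 - \<delta>) * \<theta> \<le> 1" using \<theta> by linarith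
      qed simp
      ultimately have "(\<theta> - \<eta>) * n \<le> (1 - \<delta>) * (\<theta> * (real n - M))"
        using Mn by (simp add: algebra_simps \<delta>_def)
      then have "p n * ((\<theta> - \<eta>) * n) \<le> p n * ((1 - \<delta>) * (\<theta> * (real n - M)))"
        using pn by (intro mult_left_mono) auto
      then show ?thesis by (simp add: mult_ac)
    qed
    have del: "1 / (8 * (real M * real q)\<^sup>2) * p n * (real n)\<^sup>2 = p n * (real n / (2 * M * q))\<^sup>2 / 2"
      by (simp add: power_divide power_mult_distrib field_simps)
    have "measure_pmf.prob (gnp n (p n)) {G. \<not> ?P n G} \<le>
        measure_pmf.prob (gnp n (p n)) {G. \<not> (\<exists>H. ?Q G H)}"
    proof (rule measure_pmf.finite_measure_mono)
      show "{G. \<not> ?P n G} \<subseteq> {G. \<not> (\<exists>H. ?Q G H)}"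
        unfolding del using deg by (fastforce intro: order_trans)
    qed simp
    also have "\<dots> \<le> real n * exp (- (\<delta>\<^sup>2 * (p n * (\<theta> * (real n - M))) / 2)) +
        real q ^ n * exp (- (p n * (real n / (2 * M * q))\<^sup>2 / 8))"
      using \<theta> pn \<delta>0 elim(1) by (intro prob_no_blow_up_subgraph[OF obs q]) auto
    also have "\<dots> \<le> real n * exp (- (C * (p n * real n))) + real q ^ n * exp (- (C' * (p n * real n) * real n))"
    proof (intro add_mono mult_left_mono)
      have "(\<delta>\<^sup>2 * p n * \<theta> / 2) * (real n / 2) \<le> (\<delta>\<^sup>2 * p n * \<theta> / 2) * (real n - M)"
        using elim(1) pn \<theta> by (intro mult_left_mono) auto
      then have "C * (p n * real n) \<le> \<delta>\<^sup>2 * (p n * (\<theta> * (real n - M))) / 2"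
        by (simp add: C_def mult_ac)
      then show "exp (- (\<delta>\<^sup>2 * (p n * (\<theta> * (real n - M))) / 2)) \<le> exp (- (C * (p n * real n)))"
        by simp
      have "C' * (p n * real n) * real n = p n * (real n / (2 * M * q))\<^sup>2 / 8"
        by (simp add: C'_def power_divide power_mult_distrib power2_eq_square field_simps)
      then show "exp (- (p n * (real n / (2 * M * q))\<^sup>2 / 8)) \<le> exp (- (C' * (p n * real n) * real n))"
        by (simp only: order_refl)
    qed auto
    finally show ?case .
  qed
qed

lemma ex_dense_obstruction_near_alpha:
  assumes q: "q \<ge> 2" and \<epsilon>: "(\<epsilon>::real) > 0"
  shows "\<exists>\<theta> M R. alpha_const q - \<epsilon> \<le> \<theta> \<and> 0 < \<theta> \<and> \<theta> \<le> 1 \<and> dense_obstruction q \<theta> M R"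
proof -
  consider "q = 2" | "q = 3" | "q \<ge> 4" using q by linarith
  then show ?thesis
  proof cases
    case 1
    with pentagon_obstruction \<epsilon> show ?thesis
      by (intro exI[of _ "2/5"]) (auto simp: alpha_const_def)
  next
    case 2
    with groetzsch_obstruction \<epsilon> show ?thesis
      by (intro exI[of _ "10/29"]) (auto simp: alpha_const_def)
  next
    case 3
    \<comment> \<open>The cap \<open>1/6\<close> keeps the ratio positive when
      \<open>\<epsilon>\<close> is large.\<close>
    with hajnal_obstruction[of q "min \<epsilon> (1/6)"] \<epsilon> show ?thesis
      by (intro exI[of _ "1/3 - min \<epsilon> (1/6)"]) (auto simp: alpha_const_def)
  qed
qed

section \<open>Removing triangles\<close>

text \<open>All edges of every triangle go at once. No order of deletion matters, and the survival
  of an edge depends only on whether its ends have a common neighbour.\<close>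

definition remove_triangles :: "'a ugraph \<Rightarrow> 'a ugraph" where
  "remove_triangles G = UGraph (verts G)
    {e \<in> edges G. \<not> (\<exists>x y z. e = {x, y} \<and> {y, z} \<in> edges G \<and> {x, z} \<in> edges G)}"

definition neighbourhood :: "'a ugraph \<Rightarrow> 'a \<Rightarrow> 'a set" where
  "neighbourhood G v = {u. {v, u} \<in> edges G}"

lemma simple_graph_finite_edges: "simple_graph G \<Longrightarrow> finite (edges G)"
  unfolding simple_graph_def using finite_vertex_pairs finite_subset by blast

lemma triangle_free_remove_triangles: "triangle_free (remove_triangles G)"
  unfolding triangle_free_def remove_triangles_def by auto

lemma spanning_subgraph_remove_triangles:
  "simple_graph G \<Longrightarrow> spanning_subgraph (remove_triangles G) G"
  unfolding spanning_subgraph_def simple_graph_def remove_triangles_def by auto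

text \<open>An edge \<open>{v, u}\<close> lies in a triangle exactly when \<open>u\<close> is an end
  of an edge inside the neighbourhood of \<open>v\<close>. Such an edge has two ends, hence the
  factor 2.\<close>

lemma card_removed_at_vertex:
  assumes G: "simple_graph G"
  shows "card {e \<in> edges G - edges (remove_triangles G). v \<in> e} \<le>
    2 * card (edges G \<inter> vertex_pairs (neighbourhood G v))" (is "card ?R \<le> 2 * card ?F")
proof -
  have fin: "finite ?F" using simple_graph_finite_edges[OF G] by simp
  have two: "card e = 2" "finite e" if "e \<in> ?F" for e
    using that by (auto simp: vertex_pairs_def intro: card_ge_0_finite)
  have key: "{v, u} \<in> (\<lambda>u. {v, u}) ` \<Union>?F"
    if "{v, u} \<in> edges G" "{v, w} \<in> edges G" "{u, w} \<in> edges G" for u w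
  proof -
    have "u \<noteq> w"
      using that(3) G by (auto simp: simple_graph_def vertex_pairs_def)
    then have "{u, w} \<in> ?F"
      using that by (auto simp: doubleton_in_vertex_pairs neighbourhood_def)
    then show ?thesis by blast
  qed
  have "?R \<subseteq> (\<lambda>u. {v, u}) ` \<Union>?F"
  proof
    fix e assume "e \<in> ?R"
    then obtain x y z where e: "v \<in> e" "e = {x, y}" "{x, y} \<in> edges G" "{y, z} \<in> edges G" "{x, z} \<in> edges G"
      by (auto simp: remove_triangles_def)
    then consider "v = x" | "v = y" by blast
    then show "e \<in> (\<lambda>u. {v, u}) ` \<Union>?F"
    proof cases
      case 1
      then show ?thesis using e key[of y z] by simp
    next
      case 2
      then show ?thesis using e key[of x z] by (simp add: insert_commute)
    qed
  qed
  moreover have finU: "finite (\<Union>?F)" using fin two(2) by blast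
  ultimately have "card ?R \<le> card ((\<lambda>u. {v, u}) ` \<Union>?F)" by (intro card_mono) auto
  also have "\<dots> \<le> card (\<Union>?F)" using finU by (rule card_image_le)
  also have "\<dots> \<le> (\<Sum>e\<in>?F. card e)" by (rule card_Union_le_sum_card)
  also have "\<dots> = 2 * card ?F" using two(1) by simp
  finally show ?thesis .
qed

lemma card_removed_edges:
  fixes k :: real
  assumes G: "simple_graph G"
    and k: "\<And>v. v \<in> verts G \<Longrightarrow> real (card {e \<in> edges G - edges (remove_triangles G). v \<in> e}) \<le> k"
  shows "real (card (edges G - edges (remove_triangles G))) \<le> card (verts G) * k"
proof -
  let ?R = "edges G - edges (remove_triangles G)"
  have fin: "finite (verts G)" using G by (simp add: simple_graph_def)
  have "?R \<subseteq> (\<Union>v\<in>verts G. {e \<in> ?R. v \<in> e})"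
  proof
    fix e assume e: "e \<in> ?R"
    then have "e \<in> vertex_pairs (verts G)" using G by (auto simp: simple_graph_def)
    then obtain x y where "e = {x, y}" "x \<in> verts G" by (rule vertex_pairsE)
    then show "e \<in> (\<Union>v\<in>verts G. {e \<in> ?R. v \<in> e})" using e by blast
  qed
  then have "card ?R \<le> card (\<Union>v\<in>verts G. {e \<in> ?R. v \<in> e})"
    using fin simple_graph_finite_edges[OF G] by (intro card_mono) auto
  also have "\<dots> \<le> (\<Sum>v\<in>verts G. card {e \<in> ?R. v \<in> e})"
    using fin by (rule card_UN_le)
  finally have "real (card ?R) \<le> (\<Sum>v\<in>verts G. real (card {e \<in> ?R. v \<in> e}))"
    by (simp flip: of_nat_sum)
  also have "\<dots> \<le> card (verts G) * k" using sum_bounded_above[of "verts G", OF k] by simp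
  finally show ?thesis .
qed

section \<open>Monochromatic pairs of a colouring\<close>

lemma card_vertex_pairs: "finite V \<Longrightarrow> card (vertex_pairs V) = card V choose 2"
  unfolding vertex_pairs_def by (rule n_subsets)

lemma two_card_vertex_pairs:
  "finite V \<Longrightarrow> 2 * real (card (vertex_pairs V)) = (real (card V))\<^sup>2 - real (card V)"
proof -
  assume fin: "finite V"
  have "2 * (card V choose 2) = card V * (card V - 1)"
    by (cases "card V") (simp_all add: choose_two)
  then have "2 * real (card (vertex_pairs V)) = real (card V * (card V - 1))"
    using fin by (metis card_vertex_pairs of_nat_mult of_nat_numeral)
  also have "\<dots> = (real (card V))\<^sup>2 - real (card V)"
    by (cases "card V") (simp_all add: power2_eq_square algebra_simps)
  finally show ?thesis .
qed

definition mono_pairs :: "nat \<Rightarrow> (nat \<Rightarrow> nat) \<Rightarrow> nat set set" where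
  "mono_pairs n \<phi> = {e \<in> vertex_pairs {1..n}. \<exists>x y. e = {x, y} \<and> \<phi> x = \<phi> y}"

lemma two_card_mono_pairs:
  fixes q n :: nat
  assumes \<phi>: "\<phi> \<in> {1..n} \<rightarrow> {1..q}"
  shows "2 * real (card (mono_pairs n \<phi>)) = (\<Sum>i\<in>{1..q}. (real (card {u \<in> {1..n}. \<phi> u = i}))\<^sup>2) - n"
    "(\<Sum>i\<in>{1..q}. real (card {u \<in> {1..n}. \<phi> u = i})) = n"
proof -
  let ?A = "\<lambda>i. {u \<in> {1..n}. \<phi> u = i}"
  have "(\<Sum>i\<in>{1..q}. card (?A i)) = card (\<Union>i\<in>{1..q}. ?A i)"
    by (subst card_UN_disjoint) auto
  also have "(\<Union>i\<in>{1..q}. ?A i) = {1..n}" using \<phi> by auto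
  finally have "(\<Sum>i\<in>{1..q}. card (?A i)) = n" by simp
  then show sum: "(\<Sum>i\<in>{1..q}. real (card (?A i))) = n" by (metis of_nat_sum)
  have "mono_pairs n \<phi> = (\<Union>i\<in>{1..q}. vertex_pairs (?A i))"
  proof (intro equalityI subsetI)
    fix e assume "e \<in> mono_pairs n \<phi>"
    then obtain x y where "e = {x, y}" "\<phi> x = \<phi> y" "e \<in> vertex_pairs {1..n}"
      by (auto simp: mono_pairs_def)
    then have "\<phi> x \<in> {1..q}" "e \<in> vertex_pairs (?A (\<phi> x))"
      using \<phi> by (auto simp: doubleton_in_vertex_pairs)
    then show "e \<in> (\<Union>i\<in>{1..q}. vertex_pairs (?A i))" by blast
  next
    fix e assume "e \<in> (\<Union>i\<in>{1..q}. vertex_pairs (?A i))"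
    then obtain i where "e \<in> vertex_pairs (?A i)" by blast
    then obtain x y where "e = {x, y}" "x \<in> ?A i" "y \<in> ?A i" "x \<noteq> y" by (rule vertex_pairsE)
    then show "e \<in> mono_pairs n \<phi>" by (auto simp: mono_pairs_def doubleton_in_vertex_pairs)
  qed
  moreover have "vertex_pairs (?A i) \<inter> vertex_pairs (?A j) = {}" if "i \<noteq> j" for i j
  proof (rule ccontr)
    assume "\<not> ?thesis"
    then obtain e where e: "e \<in> vertex_pairs (?A i)" "e \<in> vertex_pairs (?A j)" by blast
    from e(1) obtain x y where "e = {x, y}" "x \<in> ?A i" by (rule vertex_pairsE)
    with e(2) that show False by (auto simp: vertex_pairs_def)
  qed
  ultimately have "card (mono_pairs n \<phi>) = (\<Sum>i\<in>{1..q}. card (vertex_pairs (?A i)))"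
    by (simp add: card_UN_disjoint)
  then have "2 * real (card (mono_pairs n \<phi>)) = (\<Sum>i\<in>{1..q}. 2 * real (card (vertex_pairs (?A i))))"
    by (simp add: sum_distrib_left)
  also have "\<dots> = (\<Sum>i\<in>{1..q}. (real (card (?A i)))\<^sup>2 - real (card (?A i)))"
    by (intro sum.cong refl two_card_vertex_pairs) auto
  finally show "2 * real (card (mono_pairs n \<phi>)) = (\<Sum>i\<in>{1..q}. (real (card (?A i)))\<^sup>2) - n"
    using sum by (simp add: sum_subtractf)
qed

text \<open>The variance identity. That squares are non-negative bounds the monochromatic pairs from
  below; deviations of at most 1 bound them from above for the balanced colouring.\<close>

lemma sum_squares_deviation:
  fixes a :: "nat \<Rightarrow> real"
  assumes "(\<Sum>i\<in>{1..q}. a i) = s" "q \<ge> 1"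
  shows "(\<Sum>i\<in>{1..q}. (a i)\<^sup>2) = (\<Sum>i\<in>{1..q}. (a i - s / q)\<^sup>2) + s\<^sup>2 / q"
proof -
  have "(\<Sum>i\<in>{1..q}. (a i - s / q)\<^sup>2) =
      (\<Sum>i\<in>{1..q}. (a i)\<^sup>2) - 2 * (s / q) * (\<Sum>i\<in>{1..q}. a i) + q * (s / q)\<^sup>2"
    by (simp add: power2_diff sum.distrib sum_subtractf sum_distrib_left sum_divide_distrib mult_ac)
  also have "\<dots> = (\<Sum>i\<in>{1..q}. (a i)\<^sup>2) - s\<^sup>2 / q"
    using assms by (simp add: power2_eq_square field_simps)
  finally show ?thesis by simp
qed

lemma card_mono_pairs_ge:
  fixes q n :: nat
  assumes "\<phi> \<in> {1..n} \<rightarrow> {1..q}" "q \<ge> 1"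
  shows "(real n)\<^sup>2 / (2 * real q) - real n / 2 \<le> card (mono_pairs n \<phi>)"
proof -
  define a where "a i = real (card {u \<in> {1..n}. \<phi> u = i})" for i
  have "(\<Sum>i\<in>{1..q}. (a i)\<^sup>2) = (\<Sum>i\<in>{1..q}. (a i - real n / real q)\<^sup>2) + (real n)\<^sup>2 / real q"
    using two_card_mono_pairs(2)[OF assms(1)] assms(2) by (intro sum_squares_deviation) (auto simp: a_def)
  moreover have "0 \<le> (\<Sum>i\<in>{1..q}. (a i - real n / real q)\<^sup>2)" by (intro sum_nonneg) auto
  ultimately have "(real n)\<^sup>2 / q - n \<le> 2 * real (card (mono_pairs n \<phi>))"
    using two_card_mono_pairs(1)[OF assms(1)] unfolding a_def by linarith
  then show ?thesis by (simp add: field_simps)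
qed

lemma card_residue_class_le:
  fixes q n j :: nat
  assumes "q \<ge> 1"
  shows "card {u \<in> {1..n}. (u - 1) mod q = j} \<le> n div q + 1"
proof -
  have "inj_on (\<lambda>u. (u - 1) div q) {u \<in> {1..n}. (u - 1) mod q = j}"
  proof (rule inj_onI)
    fix u v assume *: "u \<in> {u \<in> {1..n}. (u - 1) mod q = j}" "v \<in> {u \<in> {1..n}. (u - 1) mod q = j}"
      "(u - 1) div q = (v - 1) div q"
    then have "u - 1 = v - 1" by (metis (mono_tags, lifting) div_mult_mod_eq mem_Collect_eq)
    then show "u = v" using * by auto
  qed
  moreover have "(\<lambda>u. (u - 1) div q) ` {u \<in> {1..n}. (u - 1) mod q = j} \<subseteq> {..n div q}"
    by (auto intro!: div_le_mono)
  ultimately have "card {u \<in> {1..n}. (u - 1) mod q = j} \<le> card {..n div q}"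
    by (intro card_inj_on_le) auto
  then show ?thesis by simp
qed

text \<open>The restriction makes the colouring extensional, as the minimum in
  \<open>del_partite\<close> demands.\<close>

definition balanced_colouring :: "nat \<Rightarrow> nat \<Rightarrow> nat \<Rightarrow> nat" where
  "balanced_colouring q n = restrict (\<lambda>u. (u - 1) mod q + 1) {1..n}"

lemma balanced_colouring_in_PiE: "q \<ge> 1 \<Longrightarrow> balanced_colouring q n \<in> {1..n} \<rightarrow>\<^sub>E {1..q}"
  by (auto simp: balanced_colouring_def Suc_le_eq)

text \<open>The squared deviations of the class sizes from \<open>n / q\<close> sum to at most
  \<open>q\<close>. The term \<open>- n\<close> in \<open>two_card_mono_pairs\<close> absorbs this
  when \<open>q \<le> n\<close>, so the bound carries no error term.\<close>

lemma card_mono_pairs_balanced_le: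
  fixes q n :: nat
  assumes q: "q \<ge> 1" and nq: "q \<le> n"
  shows "card (mono_pairs n (balanced_colouring q n)) \<le> (real n)\<^sup>2 / (2 * real q)"
proof -
  let ?\<phi> = "balanced_colouring q n"
  define a where "a i = real (card {u \<in> {1..n}. ?\<phi> u = i})" for i
  have \<phi>: "?\<phi> \<in> {1..n} \<rightarrow> {1..q}" using balanced_colouring_in_PiE[OF q] by blast
  have dev: "(a i - real n / real q)\<^sup>2 \<le> 1" if "i \<in> {1..q}" for i
  proof -
    have eq: "{u \<in> {1..n}. ?\<phi> u = i} = {u \<in> {1..n}. (u - 1) mod q = i - 1}"
      using that by (auto simp: balanced_colouring_def)
    have "i - 1 < q" using that by auto
    then have "n div q \<le> a i" "a i \<le> n div q + 1"
      using card_residue_class_ge[of "i - 1" q n] card_residue_class_le[OF q, of n "i - 1"]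
      unfolding a_def eq by linarith+
    moreover have "real (n div q) \<le> n / q" by (rule of_nat_div_le_of_nat)
    moreover have "n / q \<le> real (n div q) + 1"
    proof -
      have "n \<le> (n div q + 1) * q"
        using q mod_less_divisor[of q n] div_mult_mod_eq[of n q] by (simp only: distrib_right) linarith
      then have "real n \<le> real ((n div q + 1) * q)" by (rule of_nat_mono)
      then have "real n \<le> (real (n div q) + 1) * q" by (simp only: of_nat_mult of_nat_add of_nat_1)
      then show ?thesis using q by (subst pos_divide_le_eq) auto
    qed
    ultimately have "\<bar>a i - real n / real q\<bar> \<le> 1" by linarith
    then show ?thesis by (simp add: abs_square_le_1)
  qed
  have "(\<Sum>i\<in>{1..q}. (a i)\<^sup>2) = (\<Sum>i\<in>{1..q}. (a i - real n / real q)\<^sup>2) + (real n)\<^sup>2 / real q"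
    using two_card_mono_pairs(2)[OF \<phi>] q by (intro sum_squares_deviation) (auto simp: a_def)
  also have "(\<Sum>i\<in>{1..q}. (a i - real n / real q)\<^sup>2) \<le> (\<Sum>i\<in>{1..q}. 1)" using dev by (rule sum_mono)
  also have "\<dots> \<le> n" using nq by simp
  finally have "2 * real (card (mono_pairs n ?\<phi>)) \<le> (real n)\<^sup>2 / real q"
    using two_card_mono_pairs(1)[OF \<phi>] unfolding a_def by linarith
  then show ?thesis by (simp add: field_simps)
qed

section \<open>Triangle removal in the random graph\<close>

lemma verts_sample_graph [simp]: "verts (sample_graph n f) = {1..n}"
  and edges_sample_graph [simp]: "edges (sample_graph n f) = {e \<in> vertex_pairs {1..n}. f e}"
  by (simp_all add: sample_graph_def)

lemma simple_sample_graph: "simple_graph (sample_graph n f)"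
  by (auto simp: simple_graph_def)

definition star_pairs :: "nat \<Rightarrow> nat \<Rightarrow> nat set set" where
  "star_pairs n v = {e \<in> vertex_pairs {1..n}. v \<in> e}"

lemma finite_star_pairs [simp]: "finite (star_pairs n v)"
  by (simp add: star_pairs_def)

lemma card_star_pairs:
  assumes "v \<in> {1..n}"
  shows "card (star_pairs n v) = n - 1"
proof -
  have "star_pairs n v = (\<lambda>u. {v, u}) ` ({1..n} - {v})"
  proof (intro equalityI subsetI)
    fix e assume "e \<in> star_pairs n v"
    then have "e \<in> vertex_pairs {1..n}" "v \<in> e" by (auto simp: star_pairs_def)
    then show "e \<in> (\<lambda>u. {v, u}) ` ({1..n} - {v})" by (auto elim!: vertex_pairsE)
  qed (use assms in \<open>auto simp: star_pairs_def doubleton_in_vertex_pairs\<close>)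
  moreover have "inj_on (\<lambda>u. {v, u}) ({1..n} - {v})" by (auto simp: inj_on_def doubleton_eq_iff)
  ultimately show ?thesis using assms by (simp add: card_image)
qed

text \<open>The pairs at \<open>v\<close> are revealed first. They determine the neighbourhood,
  while the pairs inside it avoid \<open>v\<close> and remain independent of what was revealed.
  Fewer than \<open>d\<close> neighbours span at most \<open>d\<^sup>2 / 2\<close> pairs, and the
  adaptive tail doubles this to \<open>p * d\<^sup>2\<close>.\<close>

lemma prob_many_edges_in_neighbourhood:
  fixes p d a :: real
  assumes p: "0 \<le> p" "p \<le> 1" and v: "v \<in> {1..n}"
  shows "measure_pmf.prob (bernoulli_family (vertex_pairs {1..n}) p)
    {f. real (card {e \<in> star_pairs n v. f e}) < d \<and>
      a \<le> real (card (edges (sample_graph n f) \<inter> vertex_pairs (neighbourhood (sample_graph n f) v)))}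
    \<le> exp (p * d\<^sup>2 - a)"
proof -
  let ?E = "vertex_pairs {1..n}"
  define W where "W B = {u. {v, u} \<in> B}" for B :: "nat set set"
  define \<B> where "\<B> = {B. B \<subseteq> star_pairs n v \<and> real (card B) < d}"
  have W: "W B \<subseteq> {1..n} - {v}" if "B \<in> \<B>" for B
  proof
    fix u assume "u \<in> W B"
    then have "{v, u} \<in> vertex_pairs {1..n}" using that by (auto simp: W_def \<B>_def star_pairs_def)
    then show "u \<in> {1..n} - {v}" by (simp add: doubleton_in_vertex_pairs)
  qed
  have cardW: "real (card (vertex_pairs (W B))) \<le> d\<^sup>2 / 2" if B: "B \<in> \<B>" for B
  proof -
    have fin: "finite (W B)" using W[OF B] finite_subset by blast
    have "finite B" using B finite_subset[OF _ finite_star_pairs] by (auto simp: \<B>_def)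
    then have "card (W B) \<le> card B"
      by (intro card_inj_on_le[of "\<lambda>u. {v, u}"]) (auto simp: inj_on_def doubleton_eq_iff W_def)
    then have "real (card (W B)) \<le> d" using B by (auto simp: \<B>_def)
    then have "(real (card (W B)))\<^sup>2 \<le> d\<^sup>2" by (intro power_mono) auto
    then show ?thesis using two_card_vertex_pairs[OF fin] by simp
  qed
  have "measure_pmf.prob (bernoulli_family ?E p)
      {f. {e \<in> star_pairs n v. f e} \<in> \<B> \<and>
        a \<le> real (card {e \<in> vertex_pairs (W {e \<in> star_pairs n v. f e}). f e})}
    \<le> exp (2 * p * nat \<lfloor>d\<^sup>2 / 2\<rfloor> - a)"
  proof (rule bernoulli_family_adaptive_upper_tail)
    fix B assume B: "B \<in> \<B>"
    show "vertex_pairs (W B) \<subseteq> ?E - star_pairs n v"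
      using W[OF B] by (force simp: vertex_pairs_def star_pairs_def)
    show "card (vertex_pairs (W B)) \<le> nat \<lfloor>d\<^sup>2 / 2\<rfloor>"
      using cardW[OF B] by (simp add: le_nat_floor)
  qed (use p in \<open>auto simp: star_pairs_def\<close>)
  also have "exp (2 * p * nat \<lfloor>d\<^sup>2 / 2\<rfloor> - a) \<le> exp (p * d\<^sup>2 - a)"
  proof -
    have "real (nat \<lfloor>d\<^sup>2 / 2\<rfloor>) \<le> d\<^sup>2 / 2" by (rule of_nat_floor) simp
    then have "2 * p * nat \<lfloor>d\<^sup>2 / 2\<rfloor> \<le> 2 * p * (d\<^sup>2 / 2)" using p by (intro mult_left_mono) auto
    then show ?thesis by simp
  qed
  also have "{f. {e \<in> star_pairs n v. f e} \<in> \<B> \<and>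
        a \<le> real (card {e \<in> vertex_pairs (W {e \<in> star_pairs n v. f e}). f e})} =
      {f. real (card {e \<in> star_pairs n v. f e}) < d \<and>
      a \<le> real (card (edges (sample_graph n f) \<inter> vertex_pairs (neighbourhood (sample_graph n f) v)))}"
  proof -
    have "{e \<in> vertex_pairs (W {e \<in> star_pairs n v. f e}). f e} =
        edges (sample_graph n f) \<inter> vertex_pairs (neighbourhood (sample_graph n f) v)" for f
    proof -
      have "W {e \<in> star_pairs n v. f e} = neighbourhood (sample_graph n f) v"
        by (auto simp: W_def neighbourhood_def star_pairs_def)
      moreover have "neighbourhood (sample_graph n f) v \<subseteq> {1..n}"
        by (auto simp: neighbourhood_def doubleton_in_vertex_pairs)
      ultimately show ?thesis by (auto simp: vertex_pairs_def)
    qed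
    then show ?thesis by (auto simp: \<B>_def)
  qed
  finally show ?thesis .
qed

text \<open>Deterministic bookkeeping. Of the \<open>4 * \<epsilon>\<close> in the degree bound, one
  part is for concentration, two are for removed edges and one is for passing from
  \<open>n - 1\<close> to \<open>n\<close>. For the deletion number, the lower bound subtracts all
  removed edges from every colouring; the upper bound tests the balanced colouring, where removal
  can only help.\<close>

lemma triangle_removal_properties:
  fixes p \<epsilon> :: real
  assumes q: "q \<ge> 1" and nq: "q \<le> n" and n\<epsilon>: "1 \<le> \<epsilon> * n" and p: "0 < p" and \<epsilon>: "0 < \<epsilon>" "\<epsilon> \<le> 1"
    and deg: "\<And>v. v \<in> {1..n} \<Longrightarrow> (1 - \<epsilon>) * (p * (real n - 1)) \<le> card {e \<in> star_pairs n v. f e}"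
    and nbh: "\<And>v. v \<in> {1..n} \<Longrightarrow>
      card (edges (sample_graph n f) \<inter> vertex_pairs (neighbourhood (sample_graph n f) v)) \<le> \<epsilon> * (p * n)"
    and mono: "\<And>\<phi>. \<phi> \<in> {1..n} \<rightarrow>\<^sub>E {1..q} \<Longrightarrow>
      (1 - \<epsilon>) * (p * ((real n)\<^sup>2 / (2 * real q) - real n / 2)) \<le> card {e \<in> mono_pairs n \<phi>. f e}"
    and bal: "card {e \<in> mono_pairs n (balanced_colouring q n). f e} \<le> (1 + \<epsilon>) * (p * ((real n)\<^sup>2 / (2 * real q)))"
  defines "H \<equiv> remove_triangles (sample_graph n f)"
  shows "(1 - 4 * \<epsilon>) * p * n \<le> min_degree H"
    "\<bar>real (del_partite q H) - 1 / (2 * real q) * p * (real n)\<^sup>2\<bar> \<le> 4 * \<epsilon> * p * (real n)\<^sup>2"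
proof -
  let ?G = "sample_graph n f"
  let ?R = "edges ?G - edges H"
  have n1: "n \<ge> 1" using q nq by simp
  have V: "verts H = {1..n}" by (simp add: H_def remove_triangles_def)
  have HG: "edges H \<subseteq> edges ?G" by (auto simp: H_def remove_triangles_def)
  have fin: "finite (edges ?G)" by simp
  have rem: "real (card {e \<in> ?R. v \<in> e}) \<le> 2 * (\<epsilon> * (p * n))" if "v \<in> {1..n}" for v
    using card_removed_at_vertex[OF simple_sample_graph, of n f v] nbh[OF that] unfolding H_def by linarith
  have "real (card ?R) \<le> card (verts ?G) * (2 * (\<epsilon> * (p * n)))"
    unfolding H_def
  proof (rule card_removed_edges[OF simple_sample_graph])
    fix v assume "v \<in> verts ?G"
    then have "v \<in> {1..n}" by simp
    from rem[OF this] show "real (card {e \<in> edges ?G - edges (remove_triangles ?G). v \<in> e}) \<le> 2 * (\<epsilon> * (p * n))"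
      by (simp only: H_def)
  qed
  then have Rall: "real (card ?R) \<le> n * (2 * (\<epsilon> * (p * n)))" by simp
  have p\<epsilon>: "p \<le> \<epsilon> * (p * n)" using mult_left_mono[OF n\<epsilon>, of p] p by (simp add: mult_ac)
  show "(1 - 4 * \<epsilon>) * p * n \<le> min_degree H"
  proof (rule le_min_degree)
    fix v assume "v \<in> verts H"
    then have v: "v \<in> {1..n}" by (simp add: V)
    have "{e \<in> star_pairs n v. f e} = {e \<in> edges H. v \<in> e} \<union> {e \<in> ?R. v \<in> e}"
      using HG by (auto simp: star_pairs_def)
    then have "real (card {e \<in> star_pairs n v. f e}) \<le> vertex_degree H v + card {e \<in> ?R. v \<in> e}"
      using card_Un_le[of "{e \<in> edges H. v \<in> e}" "{e \<in> ?R. v \<in> e}"]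
      by (simp add: vertex_degree_def)
    then have "(1 - \<epsilon>) * (p * (real n - 1)) - 2 * (\<epsilon> * (p * n)) \<le> vertex_degree H v"
      using deg[OF v] rem[OF v] by linarith
    moreover have "(1 - \<epsilon>) * p \<le> p" using \<epsilon> p by simp
    moreover have "(1 - \<epsilon>) * (p * (real n - 1)) = p * n - \<epsilon> * (p * n) - (1 - \<epsilon>) * p"
      by (simp add: algebra_simps)
    moreover have "(1 - 4 * \<epsilon>) * p * n = p * n - 4 * (\<epsilon> * (p * n))" by (simp add: algebra_simps)
    ultimately show "(1 - 4 * \<epsilon>) * p * n \<le> vertex_degree H v" using p\<epsilon> by linarith
  qed (use V n1 in auto)
  define N where "N = p * (real n)\<^sup>2"
  have N0: "0 \<le> N" using p by (simp add: N_def)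
  have eN0: "0 \<le> \<epsilon> * N" using N0 \<epsilon> by simp
  have main: "1 / (2 * real q) * p * (real n)\<^sup>2 = N / (2 * real q)" "4 * \<epsilon> * p * (real n)\<^sup>2 = 4 * (\<epsilon> * N)"
    by (simp_all add: N_def)
  have small: "\<epsilon> * N / (2 * real q) \<le> \<epsilon> * N"
  proof -
    have "\<epsilon> * N * 1 \<le> \<epsilon> * N * (2 * real q)" using q eN0 by (intro mult_left_mono) auto
    then show ?thesis using q by (simp add: field_simps)
  qed
  have monoH: "mono_edges H \<phi> \<subseteq> {e \<in> mono_pairs n \<phi>. f e}"
    "{e \<in> mono_pairs n \<phi>. f e} \<subseteq> mono_edges H \<phi> \<union> ?R" for \<phi>
    using HG by (auto simp: mono_edges_def mono_pairs_def)
  have finm: "finite {e \<in> mono_pairs n \<phi>. f e}" for \<phi> by (simp add: mono_pairs_def)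
  have lower: "N / (2 * real q) - 4 * (\<epsilon> * N) \<le> del_partite q H"
  proof (rule le_del_partite)
    fix \<phi> assume "\<phi> \<in> verts H \<rightarrow>\<^sub>E {1..q}"
    then have \<phi>: "\<phi> \<in> {1..n} \<rightarrow>\<^sub>E {1..q}" by (simp add: V)
    have "card {e \<in> mono_pairs n \<phi>. f e} \<le> card (mono_edges H \<phi> \<union> ?R)"
      using monoH(2) finite_subset[OF monoH(1) finm] fin by (intro card_mono) auto
    also have "\<dots> \<le> card (mono_edges H \<phi>) + card ?R" by (rule card_Un_le)
    finally have "(1 - \<epsilon>) * (p * ((real n)\<^sup>2 / (2 * real q) - real n / 2)) - n * (2 * (\<epsilon> * (p * n)))
        \<le> card (mono_edges H \<phi>)" using mono[OF \<phi>] Rall by linarith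
    moreover have "(1 - \<epsilon>) * (p * ((real n)\<^sup>2 / (2 * real q) - real n / 2)) =
        N / (2 * real q) - \<epsilon> * N / (2 * real q) - (1 - \<epsilon>) * p * n / 2"
      by (simp add: N_def algebra_simps add_divide_distrib diff_divide_distrib)
    moreover have "real n * (2 * (\<epsilon> * (p * n))) = 2 * (\<epsilon> * N)"
      by (simp add: N_def power2_eq_square)
    moreover have "(1 - \<epsilon>) * p * n \<le> \<epsilon> * N"
    proof -
      have "(1 - \<epsilon>) * p * n \<le> 1 * p * n" using \<epsilon> p by (intro mult_right_mono) auto
      also have "\<dots> \<le> \<epsilon> * (p * n) * n" using mult_right_mono[OF p\<epsilon>, of n] by simp
      finally show ?thesis by (simp add: N_def power2_eq_square mult_ac)
    qed
    ultimately show "N / (2 * real q) - 4 * (\<epsilon> * N) \<le> card (mono_edges H \<phi>)"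
      using small eN0 by linarith
  qed (use V q in auto)
  have upper: "real (del_partite q H) \<le> N / (2 * real q) + 4 * (\<epsilon> * N)"
  proof -
    have "del_partite q H \<le> card (mono_edges H (balanced_colouring q n))"
      using balanced_colouring_in_PiE[OF q, of n] V by (intro del_partite_le) auto
    also have "\<dots> \<le> card {e \<in> mono_pairs n (balanced_colouring q n). f e}"
      using monoH(1) finm by (rule card_mono[rotated])
    finally have "real (del_partite q H) \<le> (1 + \<epsilon>) * (p * ((real n)\<^sup>2 / (2 * real q)))"
      using bal by linarith
    also have "\<dots> = N / (2 * real q) + \<epsilon> * N / (2 * real q)" by (simp add: N_def algebra_simps add_divide_distrib)
    finally show ?thesis using small eN0 by linarith
  qed
  show "\<bar>real (del_partite q H) - 1 / (2 * real q) * p * (real n)\<^sup>2\<bar> \<le> 4 * \<epsilon> * p * (real n)\<^sup>2"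
    unfolding main using lower upper by linarith
qed

lemma prob_no_triangle_free_subgraph:
  fixes p \<epsilon> :: real
  assumes q: "q \<ge> 1" and nq: "2 * q \<le> n" and n\<epsilon>: "1 \<le> \<epsilon> * n" and p: "0 < p" "p \<le> 1"
    and \<epsilon>: "0 < \<epsilon>" "\<epsilon> \<le> 1" and np: "n * p\<^sup>2 \<le> \<epsilon> / 8"
  shows "measure_pmf.prob (gnp n p) {G. \<not> (\<exists>H. spanning_subgraph H G \<and> triangle_free H \<and>
      (1 - 4 * \<epsilon>) * p * real n \<le> real (min_degree H) \<and>
      \<bar>real (del_partite q H) - 1 / (2 * real q) * p * (real n)\<^sup>2\<bar> \<le> 4 * \<epsilon> * p * (real n)\<^sup>2)}
    \<le> real n * (3 * exp (- (\<epsilon>\<^sup>2 / 4 * (p * n)))) + real q ^ n * (2 * exp (- (\<epsilon>\<^sup>2 / (8 * real q) * (p * n) * n)))"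
proof -
  let ?E = "vertex_pairs {1..n}"
  let ?D = "bernoulli_family ?E p"
  let ?\<Phi> = "{1..n} \<rightarrow>\<^sub>E {1..q}"
  let ?nb = "\<lambda>f v. real (card (edges (sample_graph n f) \<inter> vertex_pairs (neighbourhood (sample_graph n f) v)))"
  let ?\<mu> = "p * (real n - 1)" and ?\<nu> = "p * ((real n)\<^sup>2 / (2 * real q) - real n / 2)" and ?\<xi> = "p * ((real n)\<^sup>2 / (2 * real q))"
  let ?B1 = "\<lambda>v. {f. real (card {e \<in> star_pairs n v. f e}) \<le> (1 - \<epsilon>) * ?\<mu>}"
  let ?B2 = "\<lambda>v. {f. real (card {e \<in> star_pairs n v. f e}) \<ge> (1 + 1) * (p * n)}"
  \<comment> \<open>The tail bound needs a limit on the size of the neighbourhood, so the event is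
    cut off at degree \<open>2 * (p * n)\<close>. Larger degrees fall under \<open>?B2\<close>, the
    upper tail with deviation 1.\<close>
  let ?B3 = "\<lambda>v. {f. real (card {e \<in> star_pairs n v. f e}) < 2 * (p * n) \<and> \<epsilon> * (p * n) \<le> ?nb f v}"
  let ?C1 = "\<lambda>\<phi>. {f. real (card {e \<in> mono_pairs n \<phi>. f e}) \<le> (1 - \<epsilon>) * ?\<nu>}"
  let ?C2 = "{f. real (card {e \<in> mono_pairs n (balanced_colouring q n). f e}) \<ge> (1 + \<epsilon>) * ?\<xi>}"
  let ?x = "exp (- (\<epsilon>\<^sup>2 / 4 * (p * n)))" and ?y = "exp (- (\<epsilon>\<^sup>2 / (8 * real q) * (p * n) * n))"
  have n1: "n \<ge> 1" using q nq by simp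
  have pn0: "0 \<le> p * n" using p by simp
  have \<epsilon>2: "\<epsilon>\<^sup>2 \<le> \<epsilon>" "\<epsilon>\<^sup>2 \<le> 1" using \<epsilon> by (simp_all add: power2_eq_square mult_le_one mult_left_le)
  have mp: "mono_pairs n \<phi> \<subseteq> ?E" for \<phi> by (auto simp: mono_pairs_def)
  have sp: "star_pairs n v \<subseteq> ?E" for v by (auto simp: star_pairs_def)
  let ?L = "{f. \<not> (\<exists>H. spanning_subgraph H (sample_graph n f) \<and> triangle_free H \<and>
      (1 - 4 * \<epsilon>) * p * real n \<le> real (min_degree H) \<and>
      \<bar>real (del_partite q H) - 1 / (2 * real q) * p * (real n)\<^sup>2\<bar> \<le> 4 * \<epsilon> * p * (real n)\<^sup>2)}"
  have "measure_pmf.prob ?D ?L \<le> card {1..n} * (3 * ?x) + card ?\<Phi> * (2 * ?y)"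
  \<comment> \<open>\<open>?C2\<close> concerns a single colouring. Repeating it for every
    \<open>\<phi>\<close> fits the union bound over two families and costs a factor
    \<open>q ^ n\<close>, which its exponent can bear.\<close>
  proof (rule prob_Un_bounds[where B = "\<lambda>v. ?B1 v \<union> ?B2 v \<union> ?B3 v" and C = "\<lambda>\<phi>. ?C1 \<phi> \<union> ?C2"])
    show "finite ?\<Phi>" by (intro finite_PiE) auto
    show "?L \<subseteq> (\<Union>v\<in>{1..n}. ?B1 v \<union> ?B2 v \<union> ?B3 v) \<union> (\<Union>\<phi>\<in>?\<Phi>. ?C1 \<phi> \<union> ?C2)"
    proof
      fix f assume f: "f \<in> ?L"
      show "f \<in> (\<Union>v\<in>{1..n}. ?B1 v \<union> ?B2 v \<union> ?B3 v) \<union> (\<Union>\<phi>\<in>?\<Phi>. ?C1 \<phi> \<union> ?C2)"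
      proof (rule ccontr)
        assume no: "f \<notin> (\<Union>v\<in>{1..n}. ?B1 v \<union> ?B2 v \<union> ?B3 v) \<union> (\<Union>\<phi>\<in>?\<Phi>. ?C1 \<phi> \<union> ?C2)"
        have v: "f \<notin> ?B1 v \<union> ?B2 v \<union> ?B3 v" if "v \<in> {1..n}" for v
          by (rule contrapos_nn[OF no]) (rule UnI1, rule UN_I[OF that], assumption)
        have \<phi>: "f \<notin> ?C1 \<phi> \<union> ?C2" if "\<phi> \<in> ?\<Phi>" for \<phi>
          by (rule contrapos_nn[OF no]) (rule UnI2, rule UN_I[OF that], assumption)
        have dg: "(1 - \<epsilon>) * ?\<mu> \<le> card {e \<in> star_pairs n v. f e}" if "v \<in> {1..n}" for v
          using v[OF that] unfolding Un_iff mem_Collect_eq by linarith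
        have nb: "?nb f v \<le> \<epsilon> * (p * n)" if "v \<in> {1..n}" for v
          using v[OF that] unfolding Un_iff mem_Collect_eq by argo
        have mo: "(1 - \<epsilon>) * ?\<nu> \<le> card {e \<in> mono_pairs n \<phi>. f e}" if "\<phi> \<in> ?\<Phi>" for \<phi>
          using \<phi>[OF that] unfolding Un_iff mem_Collect_eq by linarith
        have ba: "card {e \<in> mono_pairs n (balanced_colouring q n). f e} \<le> (1 + \<epsilon>) * ?\<xi>"
          using \<phi>[OF balanced_colouring_in_PiE[OF q]] unfolding Un_iff mem_Collect_eq by linarith
        have "q \<le> n" using nq by simp
        note props = triangle_removal_properties[OF q this n\<epsilon> p(1) \<epsilon> dg nb mo ba]
        show False
          using f unfolding mem_Collect_eq
          by (rule notE, intro exI[of _ "remove_triangles (sample_graph n f)"])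
            (intro conjI props triangle_free_remove_triangles
              spanning_subgraph_remove_triangles simple_sample_graph)
      qed
    qed
  next
    fix v assume v: "v \<in> {1..n}"
    have c: "real (card (star_pairs n v)) = real n - 1" using card_star_pairs[OF v] n1 by simp
    have "measure_pmf.prob ?D (?B1 v) \<le> exp (- (\<epsilon>\<^sup>2 * ?\<mu> / 2))"
      using p \<epsilon> n1 sp c by (intro bernoulli_family_lower_tail) auto
    also have "\<dots> \<le> ?x"
    proof -
      have "\<epsilon>\<^sup>2 * p / 2 * (real n / 2) \<le> \<epsilon>\<^sup>2 * p / 2 * (real n - 1)"
        using p nq q by (intro mult_left_mono) auto
      then show ?thesis by (simp add: mult_ac)
    qed
    finally have b1: "measure_pmf.prob ?D (?B1 v) \<le> ?x" .
    have "measure_pmf.prob ?D (?B2 v) \<le> exp (- (1\<^sup>2 * (p * n) / 4))"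
      using p sp c n1 by (intro bernoulli_family_upper_tail) auto
    also have "\<dots> \<le> ?x" using mult_right_mono[OF \<epsilon>2(2) pn0] by simp
    finally have b2: "measure_pmf.prob ?D (?B2 v) \<le> ?x" .
    have "measure_pmf.prob ?D (?B3 v) \<le> exp (p * (2 * (p * n))\<^sup>2 - \<epsilon> * (p * n))"
      using p v by (intro prob_many_edges_in_neighbourhood) auto
    also have "\<dots> \<le> ?x"
    proof -
      \<comment> \<open>By \<open>n * p\<^sup>2 \<le> \<epsilon> / 8\<close> this term is at most
        half of the threshold \<open>\<epsilon> * (p * n)\<close>; the other half remains as the
        exponent.\<close>
      have "p * (2 * (p * n))\<^sup>2 = 4 * ((p * n) * (n * p\<^sup>2))" by (simp add: power2_eq_square)
      also have "(p * n) * (n * p\<^sup>2) \<le> (p * n) * (\<epsilon> / 8)" using np pn0 by (rule mult_left_mono)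
      finally have "p * (2 * (p * n))\<^sup>2 \<le> \<epsilon> * (p * n) / 2" by simp
      moreover have "\<epsilon>\<^sup>2 * (p * n) \<le> \<epsilon> * (p * n)" using \<epsilon>2(1) pn0 by (rule mult_right_mono)
      moreover have "0 \<le> \<epsilon> * (p * n)" using \<epsilon> pn0 by simp
      ultimately have "p * (2 * (p * n))\<^sup>2 - \<epsilon> * (p * n) \<le> - (\<epsilon>\<^sup>2 / 4 * (p * n))" by simp
      then show ?thesis by simp
    qed
    finally have b3: "measure_pmf.prob ?D (?B3 v) \<le> ?x" .
    have "measure_pmf.prob ?D (?B1 v \<union> ?B2 v \<union> ?B3 v) \<le>
        measure_pmf.prob ?D (?B1 v \<union> ?B2 v) + measure_pmf.prob ?D (?B3 v)"
      by (rule measure_Un_le) simp_all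
    also have "measure_pmf.prob ?D (?B1 v \<union> ?B2 v) \<le> measure_pmf.prob ?D (?B1 v) + measure_pmf.prob ?D (?B2 v)"
      by (rule measure_Un_le) simp_all
    finally show "measure_pmf.prob ?D (?B1 v \<union> ?B2 v \<union> ?B3 v) \<le> 3 * ?x"
      using b1 b2 b3 by linarith
  next
    fix \<phi> assume "\<phi> \<in> ?\<Phi>"
    then have \<phi>: "\<phi> \<in> {1..n} \<rightarrow> {1..q}" by blast
    \<comment> \<open>By \<open>2 * q \<le> n\<close> the linear term is at most half of the
      quadratic one.\<close>
    have \<nu>: "(real n)\<^sup>2 / (4 * real q) \<le> (real n)\<^sup>2 / (2 * real q) - real n / 2"
    proof -
      have "2 * real q * n \<le> n * real n" using nq by (intro mult_right_mono) auto
      then show ?thesis using q by (simp add: field_simps power2_eq_square)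
    qed
    have y: "\<epsilon>\<^sup>2 / (8 * real q) * (p * n) * n = \<epsilon>\<^sup>2 * (p * ((real n)\<^sup>2 / (4 * real q))) / 2"
      "\<epsilon>\<^sup>2 / (8 * real q) * (p * n) * n = \<epsilon>\<^sup>2 * ?\<xi> / 4"
      by (simp_all add: power2_eq_square)
    have "0 \<le> (real n)\<^sup>2 / (4 * real q)" by simp
    then have "measure_pmf.prob ?D (?C1 \<phi>) \<le> exp (- (\<epsilon>\<^sup>2 * ?\<nu> / 2))"
      using p \<epsilon> mp card_mono_pairs_ge[OF \<phi> q] \<nu>
      by (intro bernoulli_family_lower_tail mult_left_mono mult_nonneg_nonneg) auto
    also have "\<dots> \<le> ?y"
    proof -
      have "\<epsilon>\<^sup>2 * (p * ((real n)\<^sup>2 / (4 * real q))) \<le> \<epsilon>\<^sup>2 * ?\<nu>"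
        using \<nu> p by (intro mult_left_mono) auto
      then show ?thesis unfolding y(1) exp_le_cancel_iff neg_le_iff_le by (rule divide_right_mono) simp
    qed
    finally have c1: "measure_pmf.prob ?D (?C1 \<phi>) \<le> ?y" .
    have "measure_pmf.prob ?D ?C2 \<le> exp (- (\<epsilon>\<^sup>2 * ?\<xi> / 4))"
      using p \<epsilon> mp card_mono_pairs_balanced_le[OF q, of n] nq
      by (intro bernoulli_family_upper_tail mult_left_mono) auto
    then have c2: "measure_pmf.prob ?D ?C2 \<le> ?y" unfolding y(2) .
    have "measure_pmf.prob ?D (?C1 \<phi> \<union> ?C2) \<le> measure_pmf.prob ?D (?C1 \<phi>) + measure_pmf.prob ?D ?C2"
      by (rule measure_Un_le) simp_all
    then show "measure_pmf.prob ?D (?C1 \<phi> \<union> ?C2) \<le> 2 * ?y" using c1 c2 by linarith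
  qed simp
  moreover have "real (card ?\<Phi>) = real q ^ n" by (simp add: card_PiE)
  ultimately show ?thesis unfolding prob_gnp by simp
qed

text \<open>Turns statements for each fixed error into one with vanishing error: the index
  \<open>K n\<close> grows, but so slowly that the sequence it selects is already near its limit at
  \<open>n\<close>.\<close>

lemma ex_diagonal_rate:
  fixes f :: "nat \<Rightarrow> nat \<Rightarrow> real"
  assumes "\<And>k. (\<lambda>n. f k n) \<longlonglongrightarrow> l"
  shows "\<exists>K. filterlim K at_top sequentially \<and> (\<lambda>n. f (K n) n) \<longlonglongrightarrow> l"
proof -
  have "\<exists>N. \<forall>n\<ge>N. \<bar>f k n - l\<bar> < inverse (real (Suc k))" for k
    using LIMSEQ_D[OF assms[of k], of "inverse (real (Suc k))"] by simp
  then obtain N where N: "\<And>k n. n \<ge> N k \<Longrightarrow> \<bar>f k n - l\<bar> < inverse (real (Suc k))" by metis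
  \<comment> \<open>The largest index whose threshold \<open>n\<close> has passed. The bound
    \<open>k \<le> n\<close> keeps the set finite, and the inserted 0 is a default that matters only
    for \<open>n\<close> below \<open>N 0\<close>.\<close>
  define K where "K n = Max (insert 0 {k. k \<le> n \<and> N k \<le> n})" for n
  have K_ge: "m \<le> K n" if "m \<le> n" "N m \<le> n" for m n
    unfolding K_def using that by (intro Max_ge) auto
  have "\<forall>\<^sub>F n in sequentially. m \<le> K n" for m
    using eventually_ge_at_top[of m] eventually_ge_at_top[of "N m"] by eventually_elim (rule K_ge)
  then have K: "filterlim K at_top sequentially" by (simp add: filterlim_at_top)
  have "(\<lambda>n. f (K n) n - l) \<longlonglongrightarrow> 0"
  proof (rule Lim_null_comparison)
    show "\<forall>\<^sub>F n in sequentially. norm (f (K n) n - l) \<le> inverse (real (Suc (K n)))"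
      using eventually_ge_at_top[of "N 0"]
    proof eventually_elim
      case (elim n)
      have "K n \<in> insert 0 {k. k \<le> n \<and> N k \<le> n}" unfolding K_def by (intro Max_in) auto
      then have "N (K n) \<le> n" using elim by auto
      then show ?case using N[of "K n" n] by simp
    qed
    show "(\<lambda>n. inverse (real (Suc (K n)))) \<longlonglongrightarrow> 0"
      using filterlim_compose[OF LIMSEQ_inverse_real_of_nat K] .
  qed
  then have "(\<lambda>n. f (K n) n) \<longlonglongrightarrow> l" by (rule LIM_zero_cancel)
  with K show ?thesis by blast
qed

lemma aas_dense_nearly_extremal:
  fixes \<beta> \<epsilon> :: real and p :: "nat \<Rightarrow> real"
  assumes q: "q \<ge> 1" and \<beta>: "\<beta> < 1" and \<epsilon>: "\<epsilon> > 0"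
    and p: "\<forall>n\<ge>1. 0 < p n \<and> p n \<le> 1"
      "filterlim (\<lambda>n. p n * real n / ln (real n)) at_top sequentially"
      "(\<lambda>n. real n * (p n)\<^sup>2) \<longlonglongrightarrow> 0"
  shows "asym_almost_surely (\<lambda>n. gnp n (p n))
    (\<lambda>n G. \<exists>H. spanning_subgraph H G \<and> triangle_free H \<and>
      real (min_degree H) \<ge> \<beta> * p n * real n \<and>
      \<bar>real (del_partite q H) - 1 / (2 * real q) * p n * (real n)\<^sup>2\<bar> \<le> \<epsilon> * p n * (real n)\<^sup>2)"
    (is "asym_almost_surely _ ?P")
proof (rule aas_of_failure_bound)
  \<comment> \<open>Both the degree bound and the deletion bound spend \<open>4 * e\<close>, hence
    the quarters.\<close>
  define e where "e = min 1 (min (\<epsilon> / 4) ((1 - \<beta>) / 4))"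
  have b: "e \<le> \<epsilon> / 4" "e \<le> (1 - \<beta>) / 4"
    by (simp_all only: e_def min_le_iff_disj order_refl simp_thms)
  have e4: "4 * e \<le> \<epsilon>" using b(1) by linarith
  have e\<beta>: "\<beta> \<le> 1 - 4 * e" using b(2) by (simp add: le_divide_eq)
  have e: "0 < e" "e \<le> 1" using \<epsilon> \<beta> by (auto simp: e_def)
  have C: "e\<^sup>2 / 4 > 0" "e\<^sup>2 / (8 * real q) > 0" using e q by auto
  let ?g = "\<lambda>n. real n * (3 * exp (- (e\<^sup>2 / 4 * (p n * real n)))) +
    real q ^ n * (2 * exp (- (e\<^sup>2 / (8 * real q) * (p n * real n) * real n)))"
  show "?g \<longlonglongrightarrow> 0"
    using tendsto_add[OF tendsto_mult_left[OF linear_union_bound_tendsto_0[OF p(2) C(1)], of 3]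
        tendsto_mult_left[OF exponential_union_bound_tendsto_0[OF p(2) C(2) q], of 2]]
    by (simp add: mult_ac)
  have "\<forall>\<^sub>F n in sequentially. real n * (p n)\<^sup>2 < e / 8"
    using p(3) e(1) by (intro order_tendstoD(2)) auto
  then show "\<forall>\<^sub>F n in sequentially. measure_pmf.prob (gnp n (p n)) {G. \<not> ?P n G} \<le> ?g n"
    using eventually_ge_at_top[of "2 * q"] eventually_ge_at_top[of "nat \<lceil>1 / e\<rceil>"]
  proof eventually_elim
    case (elim n)
    have pn: "0 < p n" "p n \<le> 1" using p(1) elim(2) q by auto
    have "1 / e \<le> n" using elim(3) by linarith
    then have en: "1 \<le> e * n" using e(1) by (simp add: field_simps)
    let ?Q = "\<lambda>G H. spanning_subgraph H G \<and> triangle_free H \<and>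
      (1 - 4 * e) * p n * real n \<le> real (min_degree H) \<and>
      \<bar>real (del_partite q H) - 1 / (2 * real q) * p n * (real n)\<^sup>2\<bar> \<le> 4 * e * p n * (real n)\<^sup>2"
    have "\<beta> * p n * real n \<le> (1 - 4 * e) * p n * real n"
      using e\<beta> pn by (intro mult_right_mono) auto
    moreover have "4 * e * p n * (real n)\<^sup>2 \<le> \<epsilon> * p n * (real n)\<^sup>2"
      using e4 pn by (intro mult_right_mono) auto
    ultimately have "?P n G" if "?Q G H" for G H
      using that by (meson order_trans)
    then have "{G. \<not> ?P n G} \<subseteq> {G. \<not> (\<exists>H. ?Q G H)}" by blast
    then have "measure_pmf.prob (gnp n (p n)) {G. \<not> ?P n G} \<le>
        measure_pmf.prob (gnp n (p n)) {G. \<not> (\<exists>H. ?Q G H)}"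
      by (intro measure_pmf.finite_measure_mono) auto
    also have "\<dots> \<le> ?g n"
      using elim(1) by (intro prob_no_triangle_free_subgraph[OF q elim(2) en pn e]) simp
    finally show ?case .
  qed
qed

lemma aas_mono:
  assumes "asym_almost_surely M P" "\<And>n x. P n x \<Longrightarrow> Q n x"
  shows "asym_almost_surely M Q"
proof (rule aas_of_failure_bound)
  let ?f = "\<lambda>n. measure_pmf.prob (M n) {x. \<not> P n x}"
  have "?f n = 1 - measure_pmf.prob (M n) {x. P n x}" for n
    using measure_pmf.prob_compl[of "{x. P n x}" "M n"]
    by (simp add: Compl_eq_Diff_UNIV[symmetric] Collect_neg_eq[symmetric])
  then show "?f \<longlonglongrightarrow> 0"
    using tendsto_diff[OF tendsto_const assms(1)[unfolded asym_almost_surely_def], of 1] by simp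
  show "\<forall>\<^sub>F n in sequentially. measure_pmf.prob (M n) {x. \<not> Q n x} \<le> ?f n"
    using assms(2) by (intro always_eventually allI measure_pmf.finite_measure_mono) auto
qed

theorem theorem1p4:
  fixes q :: nat
  assumes "q \<ge> 2"
  shows
    "(\<forall>\<eta>::real. \<eta> > 0 \<longrightarrow> (\<exists>c::real. c > 0 \<and>
        (\<forall>p :: nat \<Rightarrow> real. (\<forall>n\<ge>1. 0 < p n \<and> p n \<le> 1) \<longrightarrow>
           filterlim (\<lambda>n. p n * real n / ln (real n)) at_top sequentially \<longrightarrow>
           asym_almost_surely (\<lambda>n. gnp n (p n))
             (\<lambda>n G. \<exists>H. spanning_subgraph H G \<and> triangle_free H \<and>
                real (min_degree H) \<ge> (alpha_const q - \<eta>) * p n * real n \<and>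
                real (del_partite q H) \<ge> c * p n * (real n)^2))))
     \<and>
     (\<forall>\<gamma>::real. 0 < \<gamma> \<longrightarrow> \<gamma> < 1 - alpha_const q \<longrightarrow>
        (\<forall>p :: nat \<Rightarrow> real. (\<forall>n\<ge>1. 0 < p n \<and> p n \<le> 1) \<longrightarrow>
           filterlim (\<lambda>n. p n * real n / ln (real n)) at_top sequentially \<longrightarrow>
           (\<lambda>n. real n * (p n)^2) \<longlonglongrightarrow> 0 \<longrightarrow>
           (\<exists>\<epsilon> :: nat \<Rightarrow> real. \<epsilon> \<longlonglongrightarrow> 0 \<and>
             asym_almost_surely (\<lambda>n. gnp n (p n))
               (\<lambda>n G. \<exists>H. spanning_subgraph H G \<and> triangle_free H \<and>
                  real (min_degree H) \<ge> (alpha_const q + \<gamma>) * p n * real n \<and>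
                  \<bar>real (del_partite q H) - 1 / (2 * real q) * p n * (real n)^2\<bar>
                    \<le> \<epsilon> n * p n * (real n)^2))))"
proof (intro conjI allI impI)
  fix \<eta> :: real assume \<eta>: "\<eta> > 0"
  \<comment> \<open>Half of \<open>\<eta>\<close> covers the distance from the constant to an
    attainable ratio \<open>\<theta>\<close>, the other half the randomness.\<close>
  obtain \<theta> M R where \<theta>: "alpha_const q - \<eta> / 2 \<le> \<theta>" "0 < \<theta>" "\<theta> \<le> 1"
    and obs: "dense_obstruction q \<theta> M R"
    using ex_dense_obstruction_near_alpha[OF assms, of "\<eta> / 2"] \<eta> by auto
  have M: "M \<ge> 1" using obs by (simp add: dense_obstruction_def)
  have q: "q \<ge> 1" using assms by simp
  show "\<exists>c::real. c > 0 \<and>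
        (\<forall>p :: nat \<Rightarrow> real. (\<forall>n\<ge>1. 0 < p n \<and> p n \<le> 1) \<longrightarrow>
           filterlim (\<lambda>n. p n * real n / ln (real n)) at_top sequentially \<longrightarrow>
           asym_almost_surely (\<lambda>n. gnp n (p n))
             (\<lambda>n G. \<exists>H. spanning_subgraph H G \<and> triangle_free H \<and>
                real (min_degree H) \<ge> (alpha_const q - \<eta>) * p n * real n \<and>
                real (del_partite q H) \<ge> c * p n * (real n)^2))"
  proof (intro exI[of _ "1 / (8 * (real M * real q)\<^sup>2)"] conjI allI impI)
    show "0 < 1 / (8 * (real M * real q)\<^sup>2)" using M q by simp
    fix p :: "nat \<Rightarrow> real"
    assume p: "\<forall>n\<ge>1. 0 < p n \<and> p n \<le> 1"
      "filterlim (\<lambda>n. p n * real n / ln (real n)) at_top sequentially"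
    \<comment> \<open>\<open>aas_mono\<close> compares the events for every \<open>n\<close>, while
      \<open>p 0\<close> is unconstrained; hence the separate case \<open>n = 0\<close>.\<close>
    have "(alpha_const q - \<eta>) * p n * n \<le> (\<theta> - \<eta> / 2) * p n * n" for n
      using p(1) \<theta>(1) by (cases "n = 0") (auto intro!: mult_right_mono simp: Suc_le_eq less_imp_le)
    then show "asym_almost_surely (\<lambda>n. gnp n (p n))
             (\<lambda>n G. \<exists>H. spanning_subgraph H G \<and> triangle_free H \<and>
                real (min_degree H) \<ge> (alpha_const q - \<eta>) * p n * real n \<and>
                real (del_partite q H) \<ge> 1 / (8 * (real M * real q)\<^sup>2) * p n * (real n)^2)"
      by (intro aas_mono[OF aas_dense_far_from_partite[OF obs q \<theta>(2,3) half_gt_zero[OF \<eta>] p]])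
         (blast intro: order_trans)
  qed
next
  fix \<gamma> :: real and p :: "nat \<Rightarrow> real"
  assume \<gamma>: "0 < \<gamma>" "\<gamma> < 1 - alpha_const q"
    and p: "\<forall>n\<ge>1. 0 < p n \<and> p n \<le> 1"
      "filterlim (\<lambda>n. p n * real n / ln (real n)) at_top sequentially"
      "(\<lambda>n. real n * (p n)^2) \<longlonglongrightarrow> 0"
  have q: "q \<ge> 1" and \<beta>: "alpha_const q + \<gamma> < 1" using assms \<gamma> by auto
  let ?P = "\<lambda>\<epsilon> n G. \<exists>H. spanning_subgraph H G \<and> triangle_free H \<and>
      real (min_degree H) \<ge> (alpha_const q + \<gamma>) * p n * real n \<and>
      \<bar>real (del_partite q H) - 1 / (2 * real q) * p n * (real n)^2\<bar> \<le> \<epsilon> * p n * (real n)^2"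
  have "(\<lambda>n. measure_pmf.prob (gnp n (p n)) {G. ?P (inverse (real (Suc k))) n G}) \<longlonglongrightarrow> 1" for k
    using aas_dense_nearly_extremal[OF q \<beta> _ p, of "inverse (real (Suc k))"]
    by (simp add: asym_almost_surely_def)
  from ex_diagonal_rate[of "\<lambda>k n. measure_pmf.prob (gnp n (p n)) {G. ?P (inverse (real (Suc k))) n G}",
      OF this]
  obtain K where K: "filterlim K at_top sequentially"
    "(\<lambda>n. measure_pmf.prob (gnp n (p n)) {G. ?P (inverse (real (Suc (K n)))) n G}) \<longlonglongrightarrow> 1"
    by blast
  show "\<exists>\<epsilon> :: nat \<Rightarrow> real. \<epsilon> \<longlonglongrightarrow> 0 \<and>
             asym_almost_surely (\<lambda>n. gnp n (p n))
               (\<lambda>n G. \<exists>H. spanning_subgraph H G \<and> triangle_free H \<and>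
                  real (min_degree H) \<ge> (alpha_const q + \<gamma>) * p n * real n \<and>
                  \<bar>real (del_partite q H) - 1 / (2 * real q) * p n * (real n)^2\<bar>
                    \<le> \<epsilon> n * p n * (real n)^2)"
  proof (intro exI conjI)
    show "(\<lambda>n. inverse (real (Suc (K n)))) \<longlonglongrightarrow> 0"
      using LIMSEQ_inverse_real_of_nat K(1) by (rule filterlim_compose)
    show "asym_almost_surely (\<lambda>n. gnp n (p n)) (\<lambda>n. ?P (inverse (real (Suc (K n)))) n)"
      unfolding asym_almost_surely_def by (rule K(2))
  qed
qed

end
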